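(* (a) If $0\le s\le n/2$, $s\le r\le n-s$ and $0\le t\le s$, then $\lambda_s^{r,s}(t)=\frac{(q^{s-r-1};q^{-1})_t}{(q^{n-r};q^{-1})_t}\lambda_s^{r,s}(0)$ and $\lambda_s^{n-s,r}(t)=\frac{(q^{r+s-n-1};q^{-1})_t}{(q^r;q^{-1})_t}\lambda_s^{n-s,r}(0)$; in particular $\lambda_s^{r,s}(0)\ne0$ and $\lambda_s^{n-s,r}(0)\ne0$. (b) If $0\le s\le\mathrm{N}(r_1,r_2)$, there is a unique polynomial $f_s^{r_1,r_2}$ of degree $\le s$ with $f_s^{r_1,r_2}(q^{-t})=\lambda_s^{r_1,r_2}(t)$ for $t\in\mathrm{I}_n(r_1,r_2)$; it has degree exactly $s$, and there are nonzero constants $\mathsf{c}_1,\mathsf{c}_2$ with $$f_s^{r_1,r_2}(u)=\mathsf{c}_1\sum_{k=0}^s\frac{(q^{r_2}u;q^{-1})_{s-k}(u^{-1};q^{-1})_ku^k}{(q^{s-k};q^{-1})_{s-k}(q^k;q^{-1})_k}q^{k(r_2-s+k)}\lambda_s^{r_1,s}(k)=\mathsf{c}_2\sum_{k=0}^s\frac{(q^{n-r_1}u;q^{-1})_{s-k}(u^{-1};q^{-1})_ku^k}{(q^{s-k};q^{-1})_{s-k}(q^k;q^{-1})_k}q^{k(n-r_1-s+k)}\lambda_s^{n-s,r_2}(k).$$ (c) If $0\le s\le\mathrm{N}(r_1,r_2)$, there is a nonzero constant $\mathsf{c}_0$ with $f_s^{r_1,r_2}(u)=\mathsf{c}_0f_s^{r_2,r_1}(q^{r_2-r_1}u)$.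 (d) If $0\le s\le\mathrm{N}(r_1,r_2)$, then $f_s^{r_1,r_2}(1)\ne0$ and $$\frac{f_s^{r_1,r_2}(q^{-r_2})}{f_s^{r_1,r_2}(1)}=\frac{\lambda_s^{r_1,s}(s)}{\lambda_s^{r_1,s}(0)}=(-1)^sq^{\binom{s}{2}-r_1s}\frac{(q^{r_1};q^{-1})_s}{(q^{n-r_1};q^{-1})_s},\qquad \frac{f_s^{r_1,r_2}(q^{r_1-n})}{f_s^{r_1,r_2}(1)}=\frac{\lambda_s^{n-s,r_2}(s)}{\lambda_s^{n-s,r_2}(0)}=(-1)^sq^{\binom{s}{2}+s(r_2-n)}\frac{(q^{n-r_2};q^{-1})_s}{(q^{r_2};q^{-1})_s},$$ and in particular $\frac{f_s^{r_1,r_2}(q^{r_1-r_2})}{f_s^{r_1,r_2}(1)}=q^{s(r_2-r_1)}\frac{(q^{r_1},q^{n-r_2};q^{-1})_s}{(q^{n-r_1},q^{r_2};q^{-1})_s}$. (e) If $0\le s\le\mathrm{N}(r_1,r_2)$, then $(\Lambda_s^{r_1,r_2})^*=\frac{f_s^{r_1,r_2}(1)}{f_s^{r_2,r_1}(1)}q^{s(r_2-r_1)}\frac{(q^{r_1},q^{n-r_2};q^{-1})_s}{(q^{n-r_1},q^{r_2};q^{-1})_s}\Lambda_s^{r_2,r_1}$.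
   Context: Let $q$ be a prime power, $\Omega$ an $n$-dimensional vector space over $\mathbb{F}_q$, $\mathrm{G}=\mathrm{GL}(\Omega)$, $\mathrm{X}_r$ the set of $r$-dimensional subspaces, $\partial(x,y)=\dim(x/(x\cap y))$, $\mathrm{V}_r$ the Hilbert space of functions $\mathrm{X}_r\to\mathbb{C}$ with $\mathrm{G}$ acting by $(\rho_r(g)\varphi)(x)=\varphi(g^{-1}x)$. $\mathrm{N}(r_1,r_2)=\min(r_1,r_2,n-r_1,n-r_2)$, $\mathrm{I}_n(r_1,r_2)=\{t\in\mathbb{Z}:\max(0,r_2-r_1)\le t\le\min(r_2,n-r_1)\}$. $\mathrm{G}$-equivariant $\Lambda:\mathrm{V}_{r_1}\to\mathrm{V}_{r_2}$ are exactly $\Lambda\varphi(x_2)=\sum_{x_1}\lambda(\partial(x_2,x_1))\varphi(x_1)$ with kernel $\lambda:\mathrm{I}_n(r_1,r_2)\to\mathbb{C}$. There are pairwise inequivalent irreducible representations $\pi_s$ with orthogonal decompositions into irreducible invariant subspaces $\mathrm{V}_r=\bigoplus_{s=0}^{\min(r,n-r)}\mathrm{V}_{r,s}$, $\mathrm{V}_{r,s}\simeq\pi_s$. For $0\le s\le\mathrm{N}(r_1,r_2)$, $\Lambda_s^{r_1,r_2}$ is an arbitrary fixed nonzero equivariant map $\mathrm{V}_{r_1,s}\to\mathrm{V}_{r_2,s}$ extended by $0$ on the orthogonal complement of $\mathrm{V}_{r_1,s}$, with kernel $\lambda_s^{r_1,r_2}$; $\Lambda^*$ is the Hilbert space adjoint.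 Notation: $(u;p)_k=\prod_{j=0}^{k-1}(1-p^ju)$, $(u_1,\dots,u_d;p)_k=\prod_i(u_i;p)_k$.
   Formalization: In (e) the numerator f_s^{r1,r2}(1) is replaced by its complex conjugate, since the printed formula fails for non-real normalizations (e.g. s=0, r1=r2, Λ=i·J with J the all-ones operator); for real f_s^{r1,r2}(1) it is the printed formula. *)

theory Defs
  imports Complex_Main "HOL-Library.Function_Algebras" "HOL-Computational_Algebra.Polynomial"
begin

definition qpoch :: "complex \<Rightarrow> complex \<Rightarrow> nat \<Rightarrow> complex" where
  "qpoch u p k = (\<Prod>j<k. 1 - p ^ j * u)"


section \<open>Complex vector spaces of functions and group representations\<close>

definition fscale :: "complex \<Rightarrow> ('i \<Rightarrow> complex) \<Rightarrow> ('i \<Rightarrow> complex)" where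
  "fscale c \<phi> = (\<lambda>x. c * \<phi> x)"

interpretation cfun: vector_space fscale
  by unfold_locales (simp_all add: fscale_def fun_eq_iff algebra_simps)

definition linear_on ::
    "('i \<Rightarrow> complex) set \<Rightarrow> (('i \<Rightarrow> complex) \<Rightarrow> ('j \<Rightarrow> complex)) \<Rightarrow> bool" where
  "linear_on U T \<longleftrightarrow>
     (\<forall>\<phi>\<in>U. \<forall>\<psi>\<in>U. T (\<phi> + \<psi>) = T \<phi> + T \<psi>) \<and>
     (\<forall>c. \<forall>\<phi>\<in>U. T (fscale c \<phi>) = fscale c (T \<phi>))"

text \<open>Groups are sets \<open>H\<close> of bijections of a type, multiplied by composition.  The space of a
  representation is a subspace \<open>U\<close> of a space of functions; the values of the action \<open>\<alpha>\<close> outside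
  \<open>U\<close> are irrelevant.\<close>

definition group_rep ::
    "('v \<Rightarrow> 'v) set \<Rightarrow> ('i \<Rightarrow> complex) set \<Rightarrow>
     (('v \<Rightarrow> 'v) \<Rightarrow> ('i \<Rightarrow> complex) \<Rightarrow> ('i \<Rightarrow> complex)) \<Rightarrow> bool" where
  "group_rep H U \<alpha> \<longleftrightarrow>
     cfun.subspace U \<and>
     (\<forall>g\<in>H. linear_on U (\<alpha> g) \<and> \<alpha> g ` U \<subseteq> U) \<and>
     (\<forall>\<phi>\<in>U. \<alpha> id \<phi> = \<phi>) \<and>
     (\<forall>g\<in>H. \<forall>h\<in>H. \<forall>\<phi>\<in>U. \<alpha> (g \<circ> h) \<phi> = \<alpha> g (\<alpha> h \<phi>))"

definition irreducible_rep ::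
    "('v \<Rightarrow> 'v) set \<Rightarrow> ('i \<Rightarrow> complex) set \<Rightarrow>
     (('v \<Rightarrow> 'v) \<Rightarrow> ('i \<Rightarrow> complex) \<Rightarrow> ('i \<Rightarrow> complex)) \<Rightarrow> bool" where
  "irreducible_rep H U \<alpha> \<longleftrightarrow>
     group_rep H U \<alpha> \<and> U \<noteq> {0} \<and>
     (\<forall>W. cfun.subspace W \<and> W \<subseteq> U \<and> (\<forall>g\<in>H. \<alpha> g ` W \<subseteq> W) \<longrightarrow> W = {0} \<or> W = U)"

definition equivariant_map ::
    "('v \<Rightarrow> 'v) set \<Rightarrow>
     ('i \<Rightarrow> complex) set \<Rightarrow> (('v \<Rightarrow> 'v) \<Rightarrow> ('i \<Rightarrow> complex) \<Rightarrow> ('i \<Rightarrow> complex)) \<Rightarrow>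
     ('j \<Rightarrow> complex) set \<Rightarrow> (('v \<Rightarrow> 'v) \<Rightarrow> ('j \<Rightarrow> complex) \<Rightarrow> ('j \<Rightarrow> complex)) \<Rightarrow>
     (('i \<Rightarrow> complex) \<Rightarrow> ('j \<Rightarrow> complex)) \<Rightarrow> bool" where
  "equivariant_map H U \<alpha> W \<beta> T \<longleftrightarrow>
     linear_on U T \<and> T ` U \<subseteq> W \<and> (\<forall>g\<in>H. \<forall>\<phi>\<in>U. T (\<alpha> g \<phi>) = \<beta> g (T \<phi>))"

definition equivalent_rep ::
    "('v \<Rightarrow> 'v) set \<Rightarrow>
     ('i \<Rightarrow> complex) set \<Rightarrow> (('v \<Rightarrow> 'v) \<Rightarrow> ('i \<Rightarrow> complex) \<Rightarrow> ('i \<Rightarrow> complex)) \<Rightarrow>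
     ('j \<Rightarrow> complex) set \<Rightarrow> (('v \<Rightarrow> 'v) \<Rightarrow> ('j \<Rightarrow> complex) \<Rightarrow> ('j \<Rightarrow> complex)) \<Rightarrow> bool" where
  "equivalent_rep H U \<alpha> W \<beta> \<longleftrightarrow> (\<exists>T. equivariant_map H U \<alpha> W \<beta> T \<and> bij_betw T U W)"


section \<open>The Grassmannians of a finite vector space\<close>

text \<open>Throughout, the vector space \<open>\<Omega>\<close> is the whole type \<open>'v\<close>, with scalar multiplication
  \<open>scale\<close> over the finite field \<open>'k\<close>.\<close>

definition GL :: "('k::field \<Rightarrow> 'v::ab_group_add \<Rightarrow> 'v) \<Rightarrow> ('v \<Rightarrow> 'v) set" where
  "GL scale = {g. Vector_Spaces.linear scale scale g \<and> bij g}"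

definition grassmannian :: "('k::field \<Rightarrow> 'v::ab_group_add \<Rightarrow> 'v) \<Rightarrow> nat \<Rightarrow> 'v set set" where
  "grassmannian scale r = {x. module.subspace scale x \<and> vector_space.dim scale x = r}"

text \<open>The dimension of the quotient \<open>x / (x \<inter> y)\<close>; this is not symmetric unless \<open>x\<close> and \<open>y\<close> have
  the same dimension.\<close>

definition grass_dist :: "('k::field \<Rightarrow> 'v::ab_group_add \<Rightarrow> 'v) \<Rightarrow> 'v set \<Rightarrow> 'v set \<Rightarrow> nat" where
  "grass_dist scale x y = vector_space.dim scale x - vector_space.dim scale (x \<inter> y)"

text \<open>A function on the Grassmannian is a function on all sets that vanishes off the Grassmannian.\<close>

definition grass_fun :: "('k::field \<Rightarrow> 'v::ab_group_add \<Rightarrow> 'v) \<Rightarrow> nat \<Rightarrow> ('v set \<Rightarrow> complex) set" where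
  "grass_fun scale r = {\<phi>. \<forall>x. x \<notin> grassmannian scale r \<longrightarrow> \<phi> x = 0}"

definition grass_inner ::
    "('k::field \<Rightarrow> 'v::ab_group_add \<Rightarrow> 'v) \<Rightarrow> nat \<Rightarrow>
     ('v set \<Rightarrow> complex) \<Rightarrow> ('v set \<Rightarrow> complex) \<Rightarrow> complex" where
  "grass_inner scale r \<phi> \<psi> = (\<Sum>x\<in>grassmannian scale r. \<phi> x * cnj (\<psi> x))"

definition grass_action :: "('v \<Rightarrow> 'v) \<Rightarrow> ('v set \<Rightarrow> complex) \<Rightarrow> ('v set \<Rightarrow> complex)" where
  "grass_action g \<phi> = (\<lambda>x. \<phi> (inv g ` x))"

definition grass_adjoint ::
    "('k::field \<Rightarrow> 'v::ab_group_add \<Rightarrow> 'v) \<Rightarrow> nat \<Rightarrow> nat \<Rightarrow>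
     (('v set \<Rightarrow> complex) \<Rightarrow> ('v set \<Rightarrow> complex)) \<Rightarrow>
     (('v set \<Rightarrow> complex) \<Rightarrow> ('v set \<Rightarrow> complex)) \<Rightarrow> bool" where
  "grass_adjoint scale r1 r2 \<Lambda> \<Lambda>' \<longleftrightarrow>
     (\<forall>\<psi>\<in>grass_fun scale r2. \<Lambda>' \<psi> \<in> grass_fun scale r1) \<and>
     (\<forall>\<phi>\<in>grass_fun scale r1. \<forall>\<psi>\<in>grass_fun scale r2.
        grass_inner scale r2 (\<Lambda> \<phi>) \<psi> = grass_inner scale r1 \<phi> (\<Lambda>' \<psi>))"

definition grass_N :: "nat \<Rightarrow> nat \<Rightarrow> nat \<Rightarrow> nat" where
  "grass_N n r1 r2 = min (min r1 r2) (min (n - r1) (n - r2))"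

definition grass_I :: "nat \<Rightarrow> nat \<Rightarrow> nat \<Rightarrow> nat set" where
  "grass_I n r1 r2 =
     {t. max 0 (int r2 - int r1) \<le> int t \<and> int t \<le> min (int r2) (int n - int r1)}"

text \<open>Only the values of \<open>\<kappa>\<close> on \<^term>\<open>grass_I n r1 r2\<close> matter here.\<close>

definition has_kernel ::
    "('k::field \<Rightarrow> 'v::ab_group_add \<Rightarrow> 'v) \<Rightarrow> nat \<Rightarrow> nat \<Rightarrow>
     (('v set \<Rightarrow> complex) \<Rightarrow> ('v set \<Rightarrow> complex)) \<Rightarrow> (nat \<Rightarrow> complex) \<Rightarrow> bool" where
  "has_kernel scale r1 r2 \<Lambda> \<kappa> \<longleftrightarrow>
     (\<forall>\<phi>\<in>grass_fun scale r1. \<forall>x2\<in>grassmannian scale r2.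
        \<Lambda> \<phi> x2 = (\<Sum>x1\<in>grassmannian scale r1. \<kappa> (grass_dist scale x2 x1) * \<phi> x1))"

text \<open>The representation \<open>\<pi>\<^sub>s\<close> is the action \<open>\<pi> s\<close> on the space \<open>U s\<close>, and \<open>W r s\<close> is the
  component of \<^term>\<open>grass_fun scale r\<close> equivalent to it.  These equivalences leave no freedom in the
  components: \<open>\<pi>\<^sub>s\<close> is the one constituent in degree \<open>r = s\<close> that is not present for \<open>r < s\<close>.\<close>

definition grass_decomposition ::
    "('k::field \<Rightarrow> 'v::ab_group_add \<Rightarrow> 'v) \<Rightarrow> nat \<Rightarrow>
     (nat \<Rightarrow> ('i \<Rightarrow> complex) set) \<Rightarrow>
     (nat \<Rightarrow> ('v \<Rightarrow> 'v) \<Rightarrow> ('i \<Rightarrow> complex) \<Rightarrow> ('i \<Rightarrow> complex)) \<Rightarrow>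
     (nat \<Rightarrow> nat \<Rightarrow> ('v set \<Rightarrow> complex) set) \<Rightarrow> bool" where
  "grass_decomposition scale n U \<pi> W \<longleftrightarrow>
     (\<forall>s \<le> n div 2. irreducible_rep (GL scale) (U s) (\<pi> s)) \<and>
     (\<forall>s \<le> n div 2. \<forall>s' \<le> n div 2. s \<noteq> s' \<longrightarrow>
        \<not> equivalent_rep (GL scale) (U s) (\<pi> s) (U s') (\<pi> s')) \<and>
     (\<forall>r \<le> n.
        (\<forall>s \<le> min r (n - r).
           W r s \<subseteq> grass_fun scale r \<and>
           irreducible_rep (GL scale) (W r s) grass_action \<and>
           equivalent_rep (GL scale) (W r s) grass_action (U s) (\<pi> s)) \<and>
        (\<forall>s \<le> min r (n - r). \<forall>s' \<le> min r (n - r). s \<noteq> s' \<longrightarrow>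
           (\<forall>\<phi>\<in>W r s. \<forall>\<psi>\<in>W r s'. grass_inner scale r \<phi> \<psi> = 0)) \<and>
        cfun.span (\<Union>s\<in>{..min r (n - r)}. W r s) = grass_fun scale r)"

text \<open>A nonzero equivariant map between the components \<open>W1\<close> and \<open>W2\<close>, extended linearly by zero on
  the orthogonal complement of \<open>W1\<close>.\<close>

definition component_map ::
    "('k::field \<Rightarrow> 'v::ab_group_add \<Rightarrow> 'v) \<Rightarrow> nat \<Rightarrow>
     ('v set \<Rightarrow> complex) set \<Rightarrow> ('v set \<Rightarrow> complex) set \<Rightarrow>
     (('v set \<Rightarrow> complex) \<Rightarrow> ('v set \<Rightarrow> complex)) \<Rightarrow> bool" where
  "component_map scale r1 W1 W2 \<Lambda> \<longleftrightarrow>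
     equivariant_map (GL scale) W1 grass_action W2 grass_action \<Lambda> \<and>
     (\<exists>\<phi>\<in>W1. \<Lambda> \<phi> \<noteq> 0) \<and>
     linear_on (grass_fun scale r1) \<Lambda> \<and>
     (\<forall>\<phi>\<in>grass_fun scale r1. (\<forall>\<psi>\<in>W1. grass_inner scale r1 \<phi> \<psi> = 0) \<longrightarrow> \<Lambda> \<phi> = 0)"

definition is_kernel_poly ::
    "complex \<Rightarrow> nat \<Rightarrow> nat \<Rightarrow> nat \<Rightarrow> nat \<Rightarrow> (nat \<Rightarrow> complex) \<Rightarrow> complex poly \<Rightarrow> bool" where
  "is_kernel_poly q n s r1 r2 \<kappa> p \<longleftrightarrow>
     degree p \<le> s \<and> (\<forall>t\<in>grass_I n r1 r2. poly p (q powi (- int t)) = \<kappa> t)"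

definition kernel_poly ::
    "complex \<Rightarrow> nat \<Rightarrow> nat \<Rightarrow> nat \<Rightarrow> nat \<Rightarrow> (nat \<Rightarrow> complex) \<Rightarrow> complex poly" where
  "kernel_poly q n s r1 r2 \<kappa> = (THE p. is_kernel_poly q n s r1 r2 \<kappa> p)"

text \<open>With \<open>b = r2\<close>, \<open>l = \<lambda>\<^sub>s\<^bsup>r1,s\<^esup>\<close>, and with \<open>b = n - r1\<close>, \<open>l = \<lambda>\<^sub>s\<^bsup>n-s,r2\<^esup>\<close>, this is the sum that
  represents the kernel polynomial at \<open>u\<close>.  The factor \<open>(u\<^sup>-\<^sup>1; q\<^sup>-\<^sup>1)\<^sub>k u\<^sup>k\<close> is a polynomial in \<open>u\<close>, but
  the formula has that meaning only for \<open>u \<noteq> 0\<close>, because \<open>inverse 0 = 0\<close>.\<close>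

definition kernel_sum ::
    "complex \<Rightarrow> nat \<Rightarrow> nat \<Rightarrow> (nat \<Rightarrow> complex) \<Rightarrow> complex \<Rightarrow> complex" where
  "kernel_sum q s b l u =
     (\<Sum>k\<le>s. qpoch (q ^ b * u) (inverse q) (s - k) * qpoch (inverse u) (inverse q) k * u ^ k
        / (qpoch (q ^ (s - k)) (inverse q) (s - k) * qpoch (q ^ k) (inverse q) k)
        * q powi (int k * (int b - int s + int k)) * l k)"

end

theory Submission
  imports Defs
begin

text \<open>
  The maps \<open>\<Lambda>\<^sub>s\<^bsup>r1,r2\<^esup>\<close> for \<open>s \<le> N(r1,r2)\<close> are linearly independent, and their kernels live on the set
  \<open>I(r1,r2)\<close>, which has exactly \<open>N(r1,r2) + 1\<close> elements.  So every kernel operator from \<open>V\<^sub>r\<^sub>1\<close> to \<open>V\<^sub>r\<^sub>2\<close>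
  is a combination of them, and an operator that only involves the component \<open>s\<close> is a multiple of
  \<open>\<Lambda>\<^sub>s\<^bsup>r1,r2\<^esup>\<close>, or zero if \<open>s > N(r1,r2)\<close>.

  The theorem applies this to compositions of \<open>\<Lambda>\<^sub>s\<close> with incidence operators, whose kernels are found by
  counting subspaces.  Going from dimension \<open>s\<close> to \<open>s - 1\<close>, or starting from dimension \<open>n - s + 1\<close>
  instead of \<open>n - s\<close>, gives zero, which is a two-term recursion with solution (a).  Going from \<open>s\<close> to \<open>r2\<close>,
  or from \<open>r1\<close> through \<open>n - s\<close>, gives a multiple of \<open>\<Lambda>\<^sub>s\<^bsup>r1,r2\<^esup>\<close>, which is (b).  The adjoint of
  \<open>\<Lambda>\<^sub>s\<^bsup>r1,r2\<^esup>\<close> is a multiple of \<open>\<Lambda>\<^sub>s\<^bsup>r2,r1\<^esup>\<close>; as \<open>f\<^sub>s\<close> is real up to a constant factor, this is (c), and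
  evaluation at the points where the sums in (b) have a single term gives (d) and (e).
\<close>

section \<open>Shifted factorials and kernel sums\<close>

lemma two_term_recursion:
  assumes "\<And>t. t < s \<Longrightarrow> (1 - p ^ t * b) * l (Suc t) = (1 - p ^ t * a) * l t"
    and "\<And>t. t < s \<Longrightarrow> 1 - p ^ t * b \<noteq> 0" and "t \<le> s"
  shows "l t = qpoch a p t / qpoch b p t * l 0"
  using assms(3)
proof (induction t)
  case (Suc t)
  then have "t < s" by simp
  have "l (Suc t) = (1 - p ^ t * a) * l t / (1 - p ^ t * b)"
    unfolding assms(1)[OF \<open>t < s\<close>, symmetric]
    by (rule nonzero_mult_div_cancel_left[symmetric]) (rule assms(2)[OF \<open>t < s\<close>])
  also have "l t = qpoch a p t / qpoch b p t * l 0" using Suc by simp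
  finally show ?case by (simp add: qpoch_def mult_ac)
qed (simp add: qpoch_def)

lemma qpoch_0: "qpoch u p 0 = 1"
  by (simp add: qpoch_def)

lemma qpoch_1_eq_0: "k \<noteq> 0 \<Longrightarrow> qpoch 1 p k = 0"
  unfolding qpoch_def by (rule prod_zero[OF finite_lessThan]) (auto intro!: bexI[of _ 0])

lemma prod_power_int_choose:
  assumes "q \<noteq> 0"
  shows "(\<Prod>j<s. q powi (int j - int r)) = (q :: complex) powi (int (s choose 2) - int r * int s)"
proof (induction s)
  case (Suc s)
  have "int (s choose 2) - int r * int s + (int s - int r) = int (Suc s choose 2) - int r * int (Suc s)"
    by (simp add: numeral_2_eq_2 algebra_simps)
  then show ?case using Suc assms by (simp flip: power_int_add)
qed (simp add: numeral_2_eq_2)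

text \<open>Reversing the order of the factors gives the product of
  \<open>1 - q powi (j - r)\<close>; pulling \<open>- q powi (j - r)\<close> out of each factor
  leaves \<open>1 - q powi (r - j)\<close>. This converts the value at \<open>t = s\<close> in (a)
  into the closed form in (d).\<close>

lemma qpoch_reverse:
  fixes q :: complex
  assumes "q \<noteq> 0"
  shows "qpoch (q powi (int s - int r - 1)) (inverse q) s
    = (- 1) ^ s * q powi (int (s choose 2) - int r * int s) * qpoch (q ^ r) (inverse q) s"
proof -
  have "qpoch (q powi (int s - int r - 1)) (inverse q) s = (\<Prod>j<s. 1 - q powi (int j - int r))"
    unfolding qpoch_def
  proof (rule prod.reindex_bij_witness[of _ "\<lambda>j. s - 1 - j" "\<lambda>j. s - 1 - j"])
    fix j assume "j \<in> {..<s}"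
    then have "int (s - 1 - j) - int r = - int j + (int s - int r - 1)" by auto
    then show "1 - q powi (int (s - 1 - j) - int r) = 1 - inverse q ^ j * q powi (int s - int r - 1)"
      using assms by (simp only: power_int_add power_int_minus power_int_of_nat power_inverse simp_thms)
  qed auto
  also have "\<dots> = (\<Prod>j<s. (- 1) * q powi (int j - int r) * (1 - inverse q ^ j * q ^ r))"
    using assms by (intro prod.cong) (simp_all add: power_int_diff power_inverse field_simps)
  also have "\<dots> = (- 1) ^ s * q powi (int (s choose 2) - int r * int s) * qpoch (q ^ r) (inverse q) s"
    unfolding prod.distrib prod_power_int_choose[OF assms] qpoch_def by simp
  finally show ?thesis .
qed

lemma qpoch_inverse_mult_power: "u \<noteq> 0 \<Longrightarrow> qpoch (inverse u) p k * u ^ k = (\<Prod>j<k. u - p ^ j)"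
proof (induction k)
  case (Suc k)
  have "qpoch (inverse u) p (Suc k) * u ^ Suc k
      = (qpoch (inverse u) p k * u ^ k) * ((1 - p ^ k * inverse u) * u)"
    by (simp add: qpoch_def mult_ac)
  also have "(1 - p ^ k * inverse u) * u = u - p ^ k" using Suc.prems by (simp add: algebra_simps)
  finally show ?case using Suc by simp
qed (simp add: qpoch_def)

lemma degree_prod_linear_le:
  assumes "\<And>j. j < k \<Longrightarrow> degree (f j) \<le> 1"
  shows "degree (\<Prod>j<k. f j) \<le> k"
proof -
  have "degree (\<Prod>j<k. f j) \<le> (\<Sum>j<k. degree (f j))"
    using degree_prod_sum_le[of "{..<k}" f] by (simp add: o_def)
  also have "\<dots> \<le> (\<Sum>j<k. 1)" using assms by (intro sum_mono) auto
  finally show ?thesis by simp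
qed

text \<open>Each of the \<open>k\<close> factors \<open>u\<close> clears one
  \<open>inverse u\<close>, so the summand with index \<open>k\<close> is a product of
  \<open>(s - k) + k\<close> linear factors and a constant.\<close>

lemma kernel_sum_polynomial:
  "\<exists>P. degree P \<le> s \<and> (\<forall>u. u \<noteq> 0 \<longrightarrow> poly P u = kernel_sum q s b l u)"
proof -
  define A where "A k = (\<Prod>j<k. [:1, - (inverse q ^ j * q ^ b):])" for k
  define B where "B k = (\<Prod>j<k. [:- (inverse q ^ j), 1:])" for k
  define c where "c k = q powi (int k * (int b - int s + int k)) * l k
    / (qpoch (q ^ (s - k)) (inverse q) (s - k) * qpoch (q ^ k) (inverse q) k)" for k
  define P where "P = (\<Sum>k\<le>s. smult (c k) (A (s - k) * B k))"
  have deg: "degree (A k) \<le> k" "degree (B k) \<le> k" for k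
    unfolding A_def B_def by (rule degree_prod_linear_le, simp)+
  have "degree P \<le> s" unfolding P_def
  proof (rule degree_sum_le)
    fix k assume "k \<in> {..s}"
    then show "degree (smult (c k) (A (s - k) * B k)) \<le> s"
      using degree_mult_le[of "A (s - k)" "B k"] deg[of "s - k"] deg[of k] degree_smult_le[of "c k" "A (s - k) * B k"]
      by (simp del: degree_smult_eq)
  qed simp
  moreover have "poly P u = kernel_sum q s b l u" if "u \<noteq> 0" for u
  proof -
    have "poly (A k) u = qpoch (q ^ b * u) (inverse q) k" for k
      by (simp add: A_def qpoch_def poly_prod algebra_simps)
    moreover have "poly (B k) u = qpoch (inverse u) (inverse q) k * u ^ k" for k
      by (simp add: B_def poly_prod qpoch_inverse_mult_power[OF that])
    ultimately show ?thesis unfolding P_def kernel_sum_def poly_sum poly_smult poly_mult c_def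
      by (intro sum.cong) simp_all
  qed
  ultimately show ?thesis by blast
qed

lemma kernel_sum_scale: "kernel_sum q s b (\<lambda>k. e * l k) u = e * kernel_sum q s b l u"
  unfolding kernel_sum_def by (simp add: sum_distrib_left mult_ac)

lemma kernel_sum_cong: "(\<And>k. k \<le> s \<Longrightarrow> l k = l' k) \<Longrightarrow> kernel_sum q s b l u = kernel_sum q s b l' u"
  unfolding kernel_sum_def by (intro sum.cong) simp_all

text \<open>At \<open>u = 1\<close> the second symbol contains the factor \<open>1 - 1\<close> as
  soon as \<open>k > 0\<close>, so a single term survives.\<close>

lemma kernel_sum_at_1:
  "kernel_sum q s b l 1 = qpoch (q ^ b) (inverse q) s / qpoch (q ^ s) (inverse q) s * l 0"
proof -
  have "kernel_sum q s b l 1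
      = (\<Sum>k\<le>s. if k = 0 then qpoch (q ^ b) (inverse q) s / qpoch (q ^ s) (inverse q) s * l 0 else 0)"
    unfolding kernel_sum_def by (rule sum.cong) (auto simp: qpoch_1_eq_0 qpoch_0)
  then show ?thesis by simp
qed

text \<open>Here the first symbol becomes that of 1, which vanishes unless \<open>k = s\<close>. The
  prefactor is the same as at \<open>u = 1\<close>, so it cancels in the ratios of (d).\<close>

lemma kernel_sum_at_zero_of_qpoch:
  assumes "q \<noteq> 0"
  shows "kernel_sum q s b l (q powi (- int b)) = qpoch (q ^ b) (inverse q) s / qpoch (q ^ s) (inverse q) s * l s"
proof -
  have u: "q ^ b * q powi (- int b) = 1" "inverse (q powi (- int b)) = q ^ b"
    using assms by (simp_all add: power_int_minus)
  \<comment> \<open>In the surviving term the exponent \<open>k * (b - s + k)\<close> is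
    \<open>s * b\<close>, and this power cancels \<open>u ^ s\<close>.\<close>
  have u3: "(q powi (- int b)) ^ s * q powi (int s * int b) = 1"
    unfolding power_int_power' using assms by (simp flip: power_int_add add: mult.commute)
  have "kernel_sum q s b l (q powi (- int b))
      = (\<Sum>k\<le>s. if k = s then qpoch (q ^ b) (inverse q) s / qpoch (q ^ s) (inverse q) s * l s else 0)"
    unfolding kernel_sum_def
  proof (rule sum.cong)
    fix k assume "k \<in> {..s}"
    show "qpoch (q ^ b * q powi (- int b)) (inverse q) (s - k) * qpoch (inverse (q powi (- int b))) (inverse q) k
          * (q powi (- int b)) ^ k / (qpoch (q ^ (s - k)) (inverse q) (s - k) * qpoch (q ^ k) (inverse q) k)
          * q powi (int k * (int b - int s + int k)) * l k
        = (if k = s then qpoch (q ^ b) (inverse q) s / qpoch (q ^ s) (inverse q) s * l s else 0)"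
    proof (cases "k = s")
      case True
      have "qpoch (q ^ b) (inverse q) s * (q powi (- int b)) ^ s / qpoch (q ^ s) (inverse q) s * q powi (int s * int b) * l s
          = qpoch (q ^ b) (inverse q) s / qpoch (q ^ s) (inverse q) s * l s * ((q powi (- int b)) ^ s * q powi (int s * int b))"
        by simp
      then show ?thesis unfolding u using u3 True by (simp add: qpoch_def)
    next
      case False
      with \<open>k \<in> {..s}\<close> have "qpoch 1 (inverse q) (s - k) = 0" by (intro qpoch_1_eq_0) auto
      then show ?thesis unfolding u using False by simp
    qed
  qed simp
  then show ?thesis by simp
qed

lemma cnj_qpoch: "cnj (qpoch u p k) = qpoch (cnj u) (cnj p) k"
  by (simp add: qpoch_def)

lemma cnj_power_int: "cnj (x powi k) = cnj x powi k"
  by (simp add: power_int_def)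

lemma cnj_kernel_sum:
  assumes "q \<in> \<real>" "u \<in> \<real>"
  shows "cnj (kernel_sum q s b l u) = kernel_sum q s b (\<lambda>k. cnj (l k)) u"
  using assms unfolding kernel_sum_def by (simp add: cnj_qpoch cnj_power_int Reals_cnj_iff)

text \<open>Gaussian elimination, by induction on the set of equations: an equation with a nonzero
  coefficient at \<open>j0\<close> eliminates that unknown from the others.\<close>

lemma homogeneous_system_nontrivial_solution:
  fixes A :: "'j \<Rightarrow> 'i \<Rightarrow> 'a::field"
  assumes "finite I" "finite J" "card I < card J"
  shows "\<exists>c. (\<exists>j\<in>J. c j \<noteq> 0) \<and> (\<forall>t\<in>I. (\<Sum>j\<in>J. c j * A j t) = 0)"
  using assms
proof (induction I arbitrary: J A rule: finite_induct)
  case empty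
  then have "J \<noteq> {}" by auto
  then show ?case by (intro exI[of _ "\<lambda>_. 1"]) auto
next
  case (insert t I)
  show ?case
  proof (cases "\<forall>j\<in>J. A j t = 0")
    case True
    have "card I < card J" using insert by simp
    then obtain c where "\<exists>j\<in>J. c j \<noteq> 0" "\<forall>t\<in>I. (\<Sum>j\<in>J. c j * A j t) = 0"
      using insert.IH[OF insert.prems(1)] by blast
    with True show ?thesis by (intro exI[of _ c]) auto
  next
    case False
    then obtain j0 where j0: "j0 \<in> J" "A j0 t \<noteq> 0" by blast
    define A' where "A' j u = A j u - A j t / A j0 t * A j0 u" for j u
    have "card I < card (J - {j0})" using insert j0 by simp
    then obtain c where c: "\<exists>j\<in>J - {j0}. c j \<noteq> 0" "\<forall>u\<in>I. (\<Sum>j\<in>J - {j0}. c j * A' j u) = 0"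
      using insert.IH[OF finite_Diff[OF insert.prems(1)]] by blast
    \<comment> \<open>The value at \<open>j0\<close> is the one that equation \<open>t\<close>
      forces; \<open>A'\<close> vanishes at \<open>t\<close>, so this equation holds without further
      conditions on \<open>c\<close>.\<close>
    define e where "e = c(j0 := - (\<Sum>j\<in>J - {j0}. c j * (A j t / A j0 t)))"
    have "(\<Sum>j\<in>J. e j * A j u) = (\<Sum>j\<in>J - {j0}. c j * A' j u)" for u
    proof -
      have "(\<Sum>j\<in>J. e j * A j u) = e j0 * A j0 u + (\<Sum>j\<in>J - {j0}. e j * A j u)"
        using insert.prems j0 by (intro sum.remove) auto
      also have "(\<Sum>j\<in>J - {j0}. e j * A j u) = (\<Sum>j\<in>J - {j0}. c j * A j u)"
        by (intro sum.cong) (auto simp: e_def)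
      also have "e j0 * A j0 u = - (\<Sum>j\<in>J - {j0}. c j * (A j t / A j0 t) * A j0 u)"
        by (simp add: e_def sum_distrib_right)
      finally show ?thesis by (simp add: A'_def algebra_simps sum_subtractf)
    qed
    moreover have "A' j t = 0" for j using j0 by (simp add: A'_def)
    moreover have "\<exists>j\<in>J. e j \<noteq> 0" using c(1) by (auto simp: e_def)
    ultimately show ?thesis using c(2) by (intro exI[of _ e]) auto
  qed
qed

section \<open>The index set of distances\<close>

lemma grass_I_eq: "r1 \<le> n \<Longrightarrow> r2 \<le> n \<Longrightarrow> grass_I n r1 r2 = {r2 - r1..min r2 (n - r1)}"
  unfolding grass_I_def by auto

lemma grass_I_finite [simp]: "r1 \<le> n \<Longrightarrow> r2 \<le> n \<Longrightarrow> finite (grass_I n r1 r2)"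
  by (simp add: grass_I_eq)

lemma card_grass_I: "r1 \<le> n \<Longrightarrow> r2 \<le> n \<Longrightarrow> card (grass_I n r1 r2) = Suc (grass_N n r1 r2)"
  by (auto simp: grass_I_eq grass_N_def min_def)

lemma grass_N_swap: "grass_N n r1 r2 = grass_N n r2 r1"
  by (simp add: grass_N_def min.commute)


section \<open>Counting subspaces over a finite field\<close>

locale finite_field_vector_space = finite_dimensional_vector_space scale Basis
  for scale :: "'k::{field,finite} \<Rightarrow> 'v::ab_group_add \<Rightarrow> 'v" and Basis +
  fixes q :: complex
  assumes q_eq: "q = of_nat (card (UNIV :: 'k set))"
begin

section \<open>Cardinalities of subspaces\<close>

lemma card_field_ge_2: "2 \<le> card (UNIV :: 'k set)"
proof -
  have "card {0, 1 :: 'k} \<le> card (UNIV :: 'k set)" by (rule card_mono) auto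
  then show ?thesis by simp
qed

lemma card_span_insert:
  assumes "a \<notin> span S" "finite (span S)"
  shows "finite (span (insert a S)) \<and> card (span (insert a S)) = card (UNIV :: 'k set) * card (span S)"
proof -
  define h where "h = (\<lambda>(k, x). scale k a + x)"
  have "bij_betw h (UNIV \<times> span S) (span (insert a S))"
    unfolding bij_betw_def
  proof
    show "inj_on h (UNIV \<times> span S)"
    proof (rule inj_onI)
      fix p p' assume p: "p \<in> UNIV \<times> span S" "p' \<in> UNIV \<times> span S" "h p = h p'"
      obtain k x k' x' where [simp]: "p = (k, x)" "p' = (k', x')" by fastforce
      have eq: "scale (k - k') a = x' - x"
        using p(3) by (simp add: h_def algebra_simps scale_left_diff_distrib)
      have "k = k'"
      proof (rule ccontr)
        assume "k \<noteq> k'"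
        have "scale (inverse (k - k')) (x' - x) \<in> span S"
          using p by (intro span_scale span_diff) auto
        then have "a \<in> span S" using \<open>k \<noteq> k'\<close> by (simp flip: eq)
        then show False using assms by blast
      qed
      then show "p = p'" using p(3) by (simp add: h_def)
    qed
    have "x \<in> h ` (UNIV \<times> span S)" if x: "x \<in> span (insert a S)" for x
    proof -
      obtain k where "x - scale k a \<in> span S" using x unfolding span_breakdown_eq by blast
      then have "h (k, x - scale k a) = x" "(k, x - scale k a) \<in> UNIV \<times> span S" by (auto simp: h_def)
      then show ?thesis by (metis imageI)
    qed
    moreover have "h p \<in> span (insert a S)" if "p \<in> UNIV \<times> span S" for p
    proof -
      have "span S \<subseteq> span (insert a S)" "a \<in> span (insert a S)" by (simp_all add: span_mono subset_insertI span_base)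
      then show ?thesis using that by (auto simp: h_def intro!: span_add span_scale)
    qed
    ultimately show "h ` (UNIV \<times> span S) = span (insert a S)" by blast
  qed
  note bij_betw_same_card[OF this] bij_betw_finite[OF this]
  then show ?thesis using assms by (simp add: card_cartesian_product)
qed

lemma card_span_independent:
  assumes "finite B" "independent B"
  shows "finite (span B) \<and> card (span B) = card (UNIV :: 'k set) ^ card B"
  using assms
proof (induction B rule: finite_induct)
  case (insert a B)
  then have "a \<notin> span B" "independent B" by (auto simp: independent_insert)
  with insert card_span_insert[of a B] show ?case by simp
qed simp

lemma finite_vectors [simp]: "finite (S :: 'v set)"
proof -
  have "finite (span Basis)" using card_span_independent[OF finite_Basis independent_Basis] by blast
  then show ?thesis by (rule finite_subset[rotated]) (simp add: span_Basis)
qed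

lemma finite_vector_sets [simp]: "finite (S :: 'v set set)"
proof -
  have "finite (Pow (UNIV :: 'v set))" by (simp only: finite_Pow_iff finite_vectors)
  then show ?thesis by (rule finite_subset[rotated]) auto
qed

lemma card_subspace:
  assumes "subspace S"
  shows "card S = card (UNIV :: 'k set) ^ dim S"
proof -
  obtain B where B: "B \<subseteq> S" "independent B" "S \<subseteq> span B" "card B = dim S"
    using basis_exists by blast
  then have "span B = S" using assms by (intro span_subspace)
  then show ?thesis using card_span_independent[of B] B by simp
qed

section \<open>Sums of subspaces and relative complements\<close>

definition psum :: "'v set \<Rightarrow> 'v set \<Rightarrow> 'v set" where
  "psum A B = {x + y |x y. x \<in> A \<and> y \<in> B}"

lemma subspace_psum: "subspace A \<Longrightarrow> subspace B \<Longrightarrow> subspace (psum A B)"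
  unfolding psum_def by (rule subspace_sums)

lemma psum_upper:
  assumes "subspace A" "subspace B"
  shows "A \<subseteq> psum A B" "B \<subseteq> psum A B"
proof -
  have "x + 0 \<in> psum A B" if "x \<in> A" for x
    unfolding psum_def using that subspace_0[OF assms(2)] by blast
  then show "A \<subseteq> psum A B" by auto
  have "0 + x \<in> psum A B" if "x \<in> B" for x
    unfolding psum_def using that subspace_0[OF assms(1)] by blast
  then show "B \<subseteq> psum A B" by auto
qed

lemma dim_psum: "subspace A \<Longrightarrow> subspace B \<Longrightarrow> dim (psum A B) + dim (A \<inter> B) = dim A + dim B"
  unfolding psum_def by (rule dim_sums_Int)

lemma modular_law:
  assumes "subspace A" "subspace B" "subspace Y" "A \<subseteq> Y"
  shows "Y \<inter> psum A B = psum A (Y \<inter> B)"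
proof -
  have "y \<in> Y" if "x \<in> A" "x + y \<in> Y" for x y
    using subspace_diff[OF assms(3) that(2), of x] that assms(4) by auto
  moreover have "x + y \<in> Y" if "x \<in> A" "y \<in> Y" for x y
    using subspace_add[OF assms(3)] that assms(4) by blast
  ultimately show ?thesis unfolding psum_def by blast
qed

text \<open>The number of subspaces \<open>y\<close> with \<open>Z \<subseteq> y \<subseteq> B\<close> that meet \<open>C\<close> exactly in \<open>Z\<close> and have
  dimension \<open>dim Z + k\<close>, in terms of the dimensions \<open>d\<close>, \<open>a\<close>, \<open>b\<close> of \<open>Z \<subseteq> C \<subseteq> B\<close>.\<close>

definition compl_count :: "nat \<Rightarrow> nat \<Rightarrow> nat \<Rightarrow> nat \<Rightarrow> complex" where
  "compl_count k d a b = (\<Prod>j<k. (q ^ b - q ^ (a + j)) / (q ^ (d + k) - q ^ (d + j)))"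

lemma q_power_inj [simp]: "q ^ i = q ^ j \<longleftrightarrow> i = j"
proof -
  have "q ^ i = q ^ j \<longleftrightarrow> card (UNIV :: 'k set) ^ i = card (UNIV :: 'k set) ^ j" by (metis q_eq of_nat_eq_iff of_nat_power)
  also have "\<dots> \<longleftrightarrow> i = j" using card_field_ge_2 by (intro power_inject_exp) auto
  finally show ?thesis .
qed

lemma compl_count_Suc:
  "compl_count (Suc k) d a b * (q ^ (d + Suc k) - q ^ d) = (q ^ b - q ^ a) * compl_count k (Suc d) (Suc a) b"
  using q_power_inj[of "d + Suc k" d] unfolding compl_count_def prod.lessThan_Suc_shift
  by (simp del: q_power_inj power_Suc add: o_def)

text \<open>Induction on \<open>k\<close> for all \<open>Z\<close> and \<open>C\<close> at once:
  adjoining a vector outside \<open>C\<close> to both raises their dimensions by one and lowers the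
  missing dimension \<open>k\<close> by one.\<close>

lemma card_complements:
  assumes "subspace Z" "subspace C" "subspace B" "Z \<subseteq> C" "C \<subseteq> B"
  shows "of_nat (card {y. subspace y \<and> Z \<subseteq> y \<and> y \<subseteq> B \<and> y \<inter> C = Z \<and> dim y = dim Z + k})
    = compl_count k (dim Z) (dim C) (dim B)"
  using assms
proof (induction k arbitrary: Z C)
  case 0
  have "{y. subspace y \<and> Z \<subseteq> y \<and> y \<subseteq> B \<and> y \<inter> C = Z \<and> dim y = dim Z + 0} = {Z}"
    using 0 subspace_dim_equal[of Z] by fastforce
  then show ?case by (simp add: compl_count_def)
next
  case (Suc k)
  define Y where "Y = {y. subspace y \<and> Z \<subseteq> y \<and> y \<subseteq> B \<and> y \<inter> C = Z \<and> dim y = dim Z + Suc k}"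
  define Y' where "Y' v = {y. subspace y \<and> span (insert v Z) \<subseteq> y \<and> y \<subseteq> B \<and>
      y \<inter> span (insert v C) = span (insert v Z) \<and> dim y = dim (span (insert v Z)) + k}" for v
  have ZZ: "span Z = Z" and CC: "span C = C" using Suc.prems by auto
  have di: "dim (insert v Z) = Suc (dim Z)" "dim (insert v C) = Suc (dim C)" if "v \<in> B - C" for v
    using that Suc.prems by (auto simp: dim_insert ZZ CC)
  \<comment> \<open>Double counting: \<open>y\<close> together with a vector \<open>v \<in> y - Z\<close> is the same as \<open>v \<in> B - C\<close> together with
    a subspace \<open>y\<close> that meets \<open>C + \<langle>v\<rangle>\<close> exactly in \<open>Z + \<langle>v\<rangle>\<close>.\<close>
  have eq: "Sigma Y (\<lambda>y. y - Z) = (\<lambda>(v, y). (y, v)) ` Sigma (B - C) Y'"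
  proof -
    have "(y \<in> Y \<and> v \<in> y - Z) \<longleftrightarrow> (v \<in> B - C \<and> y \<in> Y' v)" for y v
    proof
      assume l: "y \<in> Y \<and> v \<in> y - Z"
      then have v: "v \<in> B - C" unfolding Y_def by auto
      have sy: "subspace y" using l Y_def by auto
      have 1: "span (insert v Z) \<subseteq> y" using l by (intro span_minimal) (auto simp: Y_def)
      have "x \<in> span (insert v Z)" if xy: "x \<in> y" "x \<in> span (insert v C)" for x
      proof -
        obtain k where k: "x - scale k v \<in> C"
          using xy(2) unfolding span_breakdown_eq CC by blast
        moreover have "x - scale k v \<in> y" using xy(1) l sy by (auto intro!: subspace_diff subspace_scale)
        ultimately have "x - scale k v \<in> Z" using l unfolding Y_def by auto
        then show ?thesis unfolding span_breakdown_eq ZZ by blast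
      qed
      moreover have "span (insert v Z) \<subseteq> span (insert v C)"
        using Suc.prems by (intro span_mono) auto
      ultimately have "y \<inter> span (insert v C) = span (insert v Z)" using 1 by blast
      then show "v \<in> B - C \<and> y \<in> Y' v" using v l 1 by (auto simp: Y_def Y'_def di)
    next
      assume r: "v \<in> B - C \<and> y \<in> Y' v"
      have sy: "subspace y" and "span (insert v Z) \<subseteq> y" using r by (auto simp: Y'_def)
      then have v: "v \<notin> Z" "v \<in> y" and Zy: "Z \<subseteq> y"
        using r Suc.prems span_superset[of "insert v Z"] by auto
      have "x \<in> Z" if xy: "x \<in> y" "x \<in> C" for x
      proof -
        have "x \<in> y \<inter> span (insert v C)" using xy by (simp add: span_base)
        moreover have "y \<inter> span (insert v C) = span (insert v Z)" using r by (simp add: Y'_def)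
        ultimately have "x \<in> span (insert v Z)" by blast
        then obtain k where k: "x - scale k v \<in> Z" unfolding span_breakdown_eq ZZ by blast
        have "k = 0"
        proof (rule ccontr)
          assume "k \<noteq> 0"
          have "scale (inverse k) (x - (x - scale k v)) \<in> C"
            using xy k Suc.prems by (intro subspace_scale subspace_diff[of C x "x - scale k v"]) auto
          then show False using r \<open>k \<noteq> 0\<close> by simp
        qed
        then show ?thesis using k by simp
      qed
      then show "y \<in> Y \<and> v \<in> y - Z" using r v sy Zy Suc.prems by (auto simp: Y_def Y'_def di)
    qed
    then show ?thesis by fastforce
  qed
  have IH: "of_nat (card (Y' v)) = compl_count k (Suc (dim Z)) (Suc (dim C)) (dim B)" if "v \<in> B - C" for v
  proof -
    have "of_nat (card (Y' v)) = compl_count k (dim (span (insert v Z))) (dim (span (insert v C))) (dim B)"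
      unfolding Y'_def using Suc.prems that by (intro Suc.IH span_mono span_minimal) auto
    then show ?thesis using di that by simp
  qed
  have c: "of_nat (card (S - T)) = q ^ dim S - q ^ dim T" if "subspace S" "subspace T" "T \<subseteq> S" for S T
    using that card_mono[of S T] by (simp add: card_Diff_subset of_nat_diff card_subspace q_eq)
  \<comment> \<open>The fibre over each \<open>y\<close> has
    \<open>q ^ (dim Z + Suc k) - q ^ dim Z\<close> vectors; the fibre over each \<open>v\<close> is
    counted by the induction hypothesis.\<close>
  have "of_nat (card Y) * (q ^ (dim Z + Suc k) - q ^ dim Z) = (\<Sum>y\<in>Y. of_nat (card (y - Z)) :: complex)"
    using c Suc.prems by (auto simp: Y_def sum_distrib_right intro!: sum.cong)
  also have "\<dots> = of_nat (card (Sigma Y (\<lambda>y. y - Z)))"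
    by (subst card_SigmaI) (auto simp: of_nat_sum)
  also have "card (Sigma Y (\<lambda>y. y - Z)) = card (Sigma (B - C) Y')"
    unfolding eq by (intro card_image inj_onI) auto
  also have "of_nat \<dots> = (\<Sum>v\<in>B - C. of_nat (card (Y' v)) :: complex)"
    by (subst card_SigmaI) (auto simp: of_nat_sum)
  also have "\<dots> = (q ^ dim B - q ^ dim C) * compl_count k (Suc (dim Z)) (Suc (dim C)) (dim B)"
    using c Suc.prems IH by (simp flip: c)
  also have "\<dots> = compl_count (Suc k) (dim Z) (dim C) (dim B) * (q ^ (dim Z + Suc k) - q ^ dim Z)"
    by (rule compl_count_Suc[symmetric])
  finally have "of_nat (card Y) * (q ^ (dim Z + Suc k) - q ^ dim Z)
    = compl_count (Suc k) (dim Z) (dim C) (dim B) * (q ^ (dim Z + Suc k) - q ^ dim Z)" .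
  moreover have "q ^ (dim Z + Suc k) - q ^ dim Z \<noteq> 0" using q_power_inj[of "dim Z + Suc k" "dim Z"] by simp
  ultimately show ?case unfolding Y_def[symmetric] by (simp only: mult_cancel_right) simp
qed


section \<open>Gaussian binomial coefficients\<close>

lemma q_nonzero [simp]: "q \<noteq> 0" and q_neq_1 [simp]: "q \<noteq> 1"
  using card_field_ge_2 by (auto simp: q_eq)

text \<open>The Gaussian binomial coefficient in base \<open>q\<close>, written with base
  \<open>inverse q\<close> so that it matches the quotients in \<open>kernel_sum\<close>.\<close>

definition gbinom :: "nat \<Rightarrow> nat \<Rightarrow> complex" where
  "gbinom b k = qpoch (q ^ b) (inverse q) k / qpoch (q ^ k) (inverse q) k"

lemma inverse_power_mult: "j \<le> k \<Longrightarrow> inverse q ^ j * q ^ k = q ^ (k - j)"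
  by (simp add: power_inverse power_diff field_simps)

lemma qpoch_power_nonzero:
  assumes "j \<le> k"
  shows "qpoch (q ^ k) (inverse q) j \<noteq> 0"
proof -
  have "inverse q ^ i * q ^ k \<noteq> 1" if "i < j" for i
    using assms that q_power_inj[of "k - i" 0] by (simp add: inverse_power_mult)
  then show ?thesis unfolding qpoch_def by (subst prod_zero_iff) auto
qed

text \<open>The factor with index \<open>b\<close> is \<open>1 - 1\<close>. So counts with
  impossible dimensions vanish by themselves, and summation ranges may be generous.\<close>

lemma gbinom_eq_0: "b < k \<Longrightarrow> gbinom b k = 0"
  unfolding gbinom_def qpoch_def using inverse_power_mult[of b b] by (auto intro!: bexI[of _ b])

lemma gbinom_nonzero_imp_le: "gbinom b k \<noteq> 0 \<Longrightarrow> k \<le> b"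
  using gbinom_eq_0 not_le by blast

lemma gbinom_0 [simp]: "gbinom b 0 = 1"
  by (simp add: gbinom_def qpoch_def)

lemma gbinom_self [simp]: "gbinom b b = 1"
  by (simp add: gbinom_def qpoch_power_nonzero)

lemma gbinom_1: "gbinom b (Suc 0) = (q ^ b - 1) / (q - 1)"
  by (simp add: gbinom_def qpoch_def divide_simps) (simp add: algebra_simps)

text \<open>Splitting the full product of \<open>b\<close> factors after \<open>k\<close> and after
  \<open>b - k\<close> of them makes both sides equal to this product divided by the full products
  for \<open>k\<close> and \<open>b - k\<close>.\<close>

lemma gbinom_symmetric:
  assumes "k \<le> b"
  shows "gbinom b (b - k) = gbinom b k"
proof -
  have split: "qpoch (q ^ b) (inverse q) b = qpoch (q ^ b) (inverse q) j * qpoch (q ^ (b - j)) (inverse q) (b - j)"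
    if "j \<le> b" for j
  proof -
    have "qpoch (q ^ b) (inverse q) b = (\<Prod>i\<in>{..<j} \<union> {j..<b}. 1 - inverse q ^ i * q ^ b)"
      unfolding qpoch_def using that by (intro prod.cong) auto
    also have "\<dots> = qpoch (q ^ b) (inverse q) j * (\<Prod>i\<in>{j..<b}. 1 - inverse q ^ i * q ^ b)"
      unfolding qpoch_def by (rule prod.union_disjoint) auto
    also have "(\<Prod>i\<in>{j..<b}. 1 - inverse q ^ i * q ^ b) = qpoch (q ^ (b - j)) (inverse q) (b - j)"
      unfolding qpoch_def using that
      by (intro prod.reindex_bij_witness[of _ "\<lambda>i. i + j" "\<lambda>i. i - j"])
        (auto simp: inverse_power_mult)
    finally show ?thesis .
  qed
  show ?thesis
    using split[of k] split[of "b - k"] qpoch_power_nonzero[of k k] qpoch_power_nonzero[of "b - k" "b - k"] assms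
    unfolding gbinom_def by (simp add: divide_simps)
qed

text \<open>Taking \<open>- (q ^ (a + j))\<close> out of each numerator and
  \<open>- (q ^ (d + j))\<close> out of each denominator leaves \<open>k\<close> equal factors
  \<open>q ^ (a - d)\<close>.\<close>

lemma compl_count_eq_gbinom:
  assumes "d \<le> a" "a \<le> b"
  shows "compl_count k d a b = q ^ (k * (a - d)) * gbinom (b - a) k"
proof -
  have num: "q ^ b - q ^ (a + j) = - (q ^ (a + j)) * (1 - inverse q ^ j * q ^ (b - a))" for j
    using assms by (simp add: algebra_simps power_inverse power_add power_diff)
  have den: "q ^ (d + k) - q ^ (d + j) = - (q ^ (d + j)) * (1 - inverse q ^ j * q ^ k)" for j
    by (simp add: algebra_simps power_inverse power_add)
  have "(q ^ b - q ^ (a + j)) / (q ^ (d + k) - q ^ (d + j))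
      = q ^ (a - d) * ((1 - inverse q ^ j * q ^ (b - a)) / (1 - inverse q ^ j * q ^ k))" for j
    unfolding num den using assms by (simp add: power_add power_diff)
  then show ?thesis
    by (simp add: compl_count_def gbinom_def qpoch_def prod.distrib prod_dividef mult.commute[of k] flip: power_mult)
qed

text \<open>For \<open>A \<subseteq> C \<subseteq> B\<close> of dimensions \<open>a\<close>,
  \<open>g\<close>, \<open>b\<close>: the number of \<open>y\<close> between \<open>A\<close> and
  \<open>B\<close> of dimension \<open>m\<close> that meet \<open>C\<close> in dimension
  \<open>c\<close>. The first factor counts the choices of \<open>y \<inter> C\<close>, the others
  those of \<open>y\<close> once the meet is fixed.\<close>

definition meet_count :: "nat \<Rightarrow> nat \<Rightarrow> nat \<Rightarrow> nat \<Rightarrow> nat \<Rightarrow> complex" where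
  "meet_count a g b m c = gbinom (g - a) (c - a) * q ^ ((m - c) * (g - c)) * gbinom (b - g) (m - c)"

lemma card_meet:
  assumes "subspace A" "subspace C" "subspace B" "A \<subseteq> C" "C \<subseteq> B" "dim A \<le> c" "c \<le> m"
  shows "of_nat (card {y. subspace y \<and> A \<subseteq> y \<and> y \<subseteq> B \<and> dim y = m \<and> dim (y \<inter> C) = c})
    = meet_count (dim A) (dim C) (dim B) m c"
proof -
  define Zs where "Zs = {Z. subspace Z \<and> A \<subseteq> Z \<and> Z \<subseteq> C \<and> dim Z = c}"
  define Y where "Y Z = {y. subspace y \<and> Z \<subseteq> y \<and> y \<subseteq> B \<and> y \<inter> C = Z \<and> dim y = dim Z + (m - c)}" for Z
  have ACB: "dim A \<le> dim C" "dim C \<le> dim B" using assms dim_subset by auto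
  \<comment> \<open>The condition \<open>Z \<inter> A = A\<close> is automatic; it brings the set
    into the shape of \<open>card_complements\<close> with both lower spaces equal to
    \<open>A\<close>.\<close>
  have "Zs = {Z. subspace Z \<and> A \<subseteq> Z \<and> Z \<subseteq> C \<and> Z \<inter> A = A \<and> dim Z = dim A + (c - dim A)}"
    using assms by (auto simp: Zs_def)
  then have Zs: "of_nat (card Zs) = gbinom (dim C - dim A) (c - dim A)"
    using card_complements[of A A C "c - dim A"] assms ACB by (simp add: compl_count_eq_gbinom)
  have Y: "of_nat (card (Y Z)) = q ^ ((m - c) * (dim C - c)) * gbinom (dim B - dim C) (m - c)" if "Z \<in> Zs" for Z
  proof -
    have Z: "subspace Z" "Z \<subseteq> C" "dim Z = c" using that by (auto simp: Zs_def)
    then have "c \<le> dim C" using dim_subset by blast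
    then show ?thesis unfolding Y_def
      using card_complements[of Z C B "m - c"] assms ACB Z by (simp add: compl_count_eq_gbinom)
  qed
  have "{y. subspace y \<and> A \<subseteq> y \<and> y \<subseteq> B \<and> dim y = m \<and> dim (y \<inter> C) = c} = (\<Union>Z\<in>Zs. Y Z)"
  proof (intro set_eqI iffI)
    fix y assume y: "y \<in> {y. subspace y \<and> A \<subseteq> y \<and> y \<subseteq> B \<and> dim y = m \<and> dim (y \<inter> C) = c}"
    have "y \<inter> C \<in> Zs" "y \<in> Y (y \<inter> C)"
      using y assms by (auto simp: Zs_def Y_def intro: subspace_inter)
    then show "y \<in> (\<Union>Z\<in>Zs. Y Z)" by blast
  next
    fix y assume "y \<in> (\<Union>Z\<in>Zs. Y Z)"
    then show "y \<in> {y. subspace y \<and> A \<subseteq> y \<and> y \<subseteq> B \<and> dim y = m \<and> dim (y \<inter> C) = c}"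
      using assms by (auto simp: Zs_def Y_def)
  qed
  moreover have "card (\<Union>Z\<in>Zs. Y Z) = (\<Sum>Z\<in>Zs. card (Y Z))"
    by (intro card_UN_disjoint) (auto simp: Y_def)
  ultimately have "of_nat (card {y. subspace y \<and> A \<subseteq> y \<and> y \<subseteq> B \<and> dim y = m \<and> dim (y \<inter> C) = c})
      = (\<Sum>Z\<in>Zs. of_nat (card (Y Z)) :: complex)" by (simp add: of_nat_sum)
  then show ?thesis by (simp add: Y Zs meet_count_def)
qed

lemma sum_over_meet:
  fixes h :: "nat \<Rightarrow> complex"
  assumes "subspace A" "subspace C" "subspace B" "A \<subseteq> C" "C \<subseteq> B"
  shows "(\<Sum>y | subspace y \<and> A \<subseteq> y \<and> y \<subseteq> B \<and> dim y = m. h (dim (y \<inter> C)))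
    = (\<Sum>c\<in>{dim A..m}. meet_count (dim A) (dim C) (dim B) m c * h c)"
proof -
  let ?Y = "{y. subspace y \<and> A \<subseteq> y \<and> y \<subseteq> B \<and> dim y = m}"
  have "dim (y \<inter> C) \<in> {dim A..m}" if "y \<in> ?Y" for y
    using that assms dim_subset[of A "y \<inter> C"] dim_subset[of "y \<inter> C" y] by auto
  then have "(\<Sum>y\<in>?Y. h (dim (y \<inter> C))) = (\<Sum>c\<in>{dim A..m}. \<Sum>y\<in>{y\<in>?Y. dim (y \<inter> C) = c}. h (dim (y \<inter> C)))"
    by (intro sum.group[symmetric]) auto
  also have "\<dots> = (\<Sum>c\<in>{dim A..m}. of_nat (card {y\<in>?Y. dim (y \<inter> C) = c}) * h c)"
    by (intro sum.cong) auto
  also have "\<dots> = (\<Sum>c\<in>{dim A..m}. meet_count (dim A) (dim C) (dim B) m c * h c)"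
    using card_meet[OF assms] by (intro sum.cong) (auto simp: conj_ac)
  finally show ?thesis .
qed

section \<open>Sums over subspaces incident with a given one\<close>

abbreviation X :: "nat \<Rightarrow> 'v set set" where "X \<equiv> grassmannian scale"
abbreviation dist :: "'v set \<Rightarrow> 'v set \<Rightarrow> nat" where "dist \<equiv> grass_dist scale"

lemma mem_X: "x \<in> X r \<longleftrightarrow> subspace x \<and> dim x = r"
  by (simp add: grassmannian_def)

lemma dim_Int_eq_dist:
  assumes "x2 \<in> X r2"
  shows "dist x2 x1 \<le> r2" "dim (x2 \<inter> x1) = r2 - dist x2 x1" "dist x2 x1 = r2 - dim (x2 \<inter> x1)"
  using assms dim_subset[of "x2 \<inter> x1" x2] by (auto simp: mem_X grass_dist_def)

lemma dim_psum_eq_dist: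
  assumes "x1 \<in> X r1" "x2 \<in> X r2"
  shows "dim (psum x1 x2) = r1 + dist x2 x1"
  using dim_psum[of x1 x2] dim_Int_eq_dist(1,2)[OF assms(2), of x1] assms by (auto simp: mem_X Int_commute)

lemma dist_mem_I:
  assumes "x1 \<in> X r1" "x2 \<in> X r2"
  shows "dist x2 x1 \<in> grass_I (dim UNIV) r1 r2"
proof -
  have 1: "r1 + dist x2 x1 \<le> dim UNIV"
    unfolding dim_psum_eq_dist[OF assms, symmetric] by (rule dim_subset) (rule subset_UNIV)
  have "dim (x2 \<inter> x1) \<le> r1" using assms(1) dim_subset[of "x2 \<inter> x1" x1] by (simp add: mem_X)
  then have "r2 \<le> r1 + dist x2 x1" "dist x2 x1 \<le> r2"
    using dim_Int_eq_dist(1,2)[OF assms(2), of x1] by linarith+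
  with 1 show ?thesis unfolding grass_I_def by (simp del: dim_UNIV)
qed

text \<open>Inside \<open>x2\<close>, a subspace \<open>y\<close> meets \<open>x1\<close> exactly
  where it meets \<open>x2 \<inter> x1\<close>, so grouping by the dimension \<open>s - k\<close> of
  this meet is the same as grouping by the distance \<open>k\<close>.\<close>

lemma sum_below:
  assumes x1: "x1 \<in> X r1" and x2: "x2 \<in> X r2"
  defines "t \<equiv> dist x2 x1"
  shows "(\<Sum>y | y \<in> X s \<and> y \<subseteq> x2. l (dist y x1))
    = (\<Sum>k\<le>s. gbinom (r2 - t) (s - k) * gbinom t k * q ^ (k * (r2 - t - (s - k))) * l k)"
proof -
  have sub: "subspace x1" "subspace x2" "subspace (x2 \<inter> x1)" using x1 x2 by (auto simp: mem_X subspace_inter)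
  have dC: "dim (x2 \<inter> x1) = r2 - t" and t: "t \<le> r2" and d2: "dim x2 = r2"
    using dim_Int_eq_dist(1,2)[OF x2, of x1] x2 by (auto simp: t_def mem_X)
  have "(\<Sum>y | y \<in> X s \<and> y \<subseteq> x2. l (dist y x1))
      = (\<Sum>y | subspace y \<and> {0} \<subseteq> y \<and> y \<subseteq> x2 \<and> dim y = s. l (s - dim (y \<inter> (x2 \<inter> x1))))"
  proof (rule sum.cong)
    fix y assume "y \<in> {y. subspace y \<and> {0} \<subseteq> y \<and> y \<subseteq> x2 \<and> dim y = s}"
    then have "y \<in> X s" "y \<inter> (x2 \<inter> x1) = y \<inter> x1" by (auto simp: mem_X)
    then show "l (dist y x1) = l (s - dim (y \<inter> (x2 \<inter> x1)))" by (simp add: dim_Int_eq_dist(3))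
  qed (auto simp: mem_X subspace_0)
  also have "\<dots> = (\<Sum>c\<in>{0..s}. meet_count 0 (r2 - t) r2 s c * l (s - c))"
    using sum_over_meet[of "{0}" "x2 \<inter> x1" x2 "\<lambda>c. l (s - c)" s] sub by (simp add: subspace_0 dC d2)
  also have "\<dots> = (\<Sum>k\<le>s. meet_count 0 (r2 - t) r2 s (s - k) * l k)"
    by (rule sum.reindex_bij_witness[of _ "\<lambda>k. s - k" "\<lambda>k. s - k"]) auto
  finally show ?thesis using t by (simp add: meet_count_def ac_simps)
qed

text \<open>By the modular law, \<open>z\<close> meets the sum of \<open>x1\<close> and
  \<open>x2\<close> in the sum of \<open>x1\<close> and \<open>x2 \<inter> z\<close>. This reduces
  distances from \<open>z\<close> to meets with one fixed space above \<open>x1\<close>.\<close>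

lemma dim_Int_psum:
  assumes "x1 \<in> X r1" "x2 \<in> X r2" "subspace z" "x1 \<subseteq> z"
  shows "dim (z \<inter> psum x1 x2) + dim (x2 \<inter> x1) = r1 + dim (x2 \<inter> z)"
proof -
  have "z \<inter> psum x1 x2 = psum x1 (x2 \<inter> z)"
    using modular_law[of x1 x2 z] assms unfolding Int_commute[of x2 z] by (simp add: mem_X)
  moreover have "x1 \<inter> (x2 \<inter> z) = x2 \<inter> x1" using assms by auto
  ultimately show ?thesis
    using dim_psum[of x1 "x2 \<inter> z"] assms by (simp add: mem_X subspace_inter)
qed

text \<open>The dual of \<open>sum_below\<close>: \<open>z\<close> is grouped by its meet with the
  sum of \<open>x1\<close> and \<open>x2\<close>. Symmetry of the binomial coefficients then gives
  the same expression with \<open>n - r1\<close> in place of \<open>r2\<close>.\<close>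

lemma sum_above:
  assumes x1: "x1 \<in> X r1" and x2: "x2 \<in> X r2"
  defines "t \<equiv> dist x2 x1" and "n \<equiv> dim (UNIV :: 'v set)"
  assumes s: "s \<le> n - r1"
  shows "(\<Sum>z | z \<in> X (n - s) \<and> x1 \<subseteq> z. l (dist x2 z))
    = (\<Sum>k\<le>s. gbinom (n - r1 - t) (s - k) * gbinom t k * q ^ (k * (n - r1 - t - (s - k))) * l k)"
proof -
  have sub: "subspace x1" "subspace x2" "subspace (psum x1 x2)" and d: "dim x1 = r1"
    using x1 x2 by (auto simp: mem_X subspace_psum)
  have dC: "dim (psum x1 x2) = r1 + t" using dim_psum_eq_dist[OF x1 x2] by (simp add: t_def)
  have rt: "r1 + t \<le> n" unfolding dC[symmetric] n_def by (rule dim_subset) (rule subset_UNIV)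
  have "(\<Sum>z | z \<in> X (n - s) \<and> x1 \<subseteq> z. l (dist x2 z))
      = (\<Sum>z | subspace z \<and> x1 \<subseteq> z \<and> z \<subseteq> UNIV \<and> dim z = n - s. l (r1 + t - dim (z \<inter> psum x1 x2)))"
  proof (rule sum.cong)
    fix z assume "z \<in> {z. subspace z \<and> x1 \<subseteq> z \<and> z \<subseteq> UNIV \<and> dim z = n - s}"
    then have "dim (z \<inter> psum x1 x2) + dim (x2 \<inter> x1) = r1 + dim (x2 \<inter> z)"
      using dim_Int_psum[OF x1 x2, of z] by auto
    then have "dist x2 z = r1 + t - dim (z \<inter> psum x1 x2)"
      using dim_Int_eq_dist(1,2)[OF x2, of z] dim_Int_eq_dist(1,2)[OF x2, of x1] unfolding t_def by linarith
    then show "l (dist x2 z) = l (r1 + t - dim (z \<inter> psum x1 x2))" by simp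
  qed (auto simp: mem_X)
  also have "\<dots> = (\<Sum>c\<in>{r1..n - s}. meet_count r1 (r1 + t) n (n - s) c * l (r1 + t - c))"
    using sum_over_meet[of x1 "psum x1 x2" UNIV "\<lambda>c. l (r1 + t - c)" "n - s"] sub psum_upper[of x1 x2]
    by (simp add: dC d n_def del: dim_UNIV)
  also have "\<dots> = (\<Sum>k\<le>s. gbinom (n - r1 - t) (s - k) * gbinom t k * q ^ (k * (n - r1 - t - (s - k))) * l k)"
  proof -
    \<comment> \<open>Both ranges are cut down so that the omitted terms have a vanishing binomial
      coefficient. On what remains no subtraction truncates, and \<open>c = r1 + t - k\<close> is a
      bijection.\<close>
    define S where "S = {c\<in>{r1..n - s}. c \<le> r1 + t \<and> r1 + t \<le> c + s}"
    define T where "T = {k\<in>{..s}. k \<le> t \<and> s - k \<le> n - r1 - t}"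
    have "meet_count r1 (r1 + t) n (n - s) c * l (r1 + t - c) = 0" if "c \<in> {r1..n - s} - S" for c
    proof -
      have "t < c - r1 \<or> n - (r1 + t) < n - s - c" using that rt unfolding S_def by (simp, linarith)
      then show ?thesis by (auto simp: meet_count_def gbinom_eq_0)
    qed
    then have "(\<Sum>c\<in>{r1..n - s}. meet_count r1 (r1 + t) n (n - s) c * l (r1 + t - c))
        = (\<Sum>c\<in>S. meet_count r1 (r1 + t) n (n - s) c * l (r1 + t - c))"
      by (intro sum.mono_neutral_right) (auto simp: S_def)
    also have "\<dots> = (\<Sum>k\<in>T. gbinom (n - r1 - t) (s - k) * gbinom t k * q ^ (k * (n - r1 - t - (s - k))) * l k)"
    proof (rule sum.reindex_bij_witness[of _ "\<lambda>k. r1 + t - k" "\<lambda>c. r1 + t - c"])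
    fix c assume "c \<in> S"
    then have c: "r1 \<le> c" "c \<le> n - s" "c \<le> r1 + t" "r1 + t \<le> c + s" by (auto simp: S_def)
    then show "r1 + t - (r1 + t - c) = c" by simp
    define k where "k = r1 + t - c"
    have k: "k \<le> t" "k \<le> s" "s - k \<le> n - r1 - t" unfolding k_def using c rt s by linarith+
    then show "r1 + t - c \<in> T" by (simp add: T_def k_def[symmetric])
    have e: "n - s - c = n - r1 - t - (s - k)" "c - r1 = t - k" "n - s - c + (s - k) = n - r1 - t"
      "r1 + t - r1 = t" "n - (r1 + t) = n - r1 - t"
      unfolding k_def using c rt s by linarith+
    show "gbinom (n - r1 - t) (s - (r1 + t - c)) * gbinom t (r1 + t - c)
          * q ^ ((r1 + t - c) * (n - r1 - t - (s - (r1 + t - c)))) * l (r1 + t - c)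
        = meet_count r1 (r1 + t) n (n - s) c * l (r1 + t - c)"
      unfolding meet_count_def k_def[symmetric] e(1,2,4,5) gbinom_symmetric[OF k(1)] gbinom_symmetric[OF k(3)]
      by (simp add: mult.commute)
  next
    fix k assume "k \<in> T"
    then have k: "k \<le> s" "k \<le> t" "s - k \<le> n - r1 - t" by (auto simp: T_def)
    then show "r1 + t - (r1 + t - k) = k" by simp
    have "r1 \<le> r1 + t - k" "r1 + t - k \<le> n - s" "r1 + t - k \<le> r1 + t" "r1 + t \<le> r1 + t - k + s"
      using k s rt by linarith+
    then show "r1 + t - k \<in> S" by (simp add: S_def)
    qed
    also have "\<dots> = (\<Sum>k\<le>s. gbinom (n - r1 - t) (s - k) * gbinom t k * q ^ (k * (n - r1 - t - (s - k))) * l k)"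
      by (rule sum.mono_neutral_left) (auto simp: T_def dest: gbinom_nonzero_imp_le)
    finally show ?thesis .
  qed
  finally show ?thesis .
qed


text \<open>A space \<open>z\<close> one dimension above \<open>y\<close> either lies in the sum of
  \<open>y\<close> and \<open>x\<close>, with distance still \<open>t\<close>, or leaves it, with
  distance \<open>t + 1\<close>. The factor on the left clears the denominators.\<close>

lemma sum_above_one:
  assumes y: "y \<in> X s" and x: "x \<in> X r"
  defines "t \<equiv> dist y x" and "n \<equiv> dim (UNIV :: 'v set)"
  shows "(q ^ Suc s - q ^ s) * (\<Sum>z | z \<in> X (Suc s) \<and> y \<subseteq> z. l (dist z x))
    = (q ^ (r + t) - q ^ s) * l t + (q ^ n - q ^ (r + t)) * l (Suc t)"
proof -
  have sub: "subspace y" "subspace x" "subspace (psum y x)" and d: "dim y = s"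
    using x y by (auto simp: mem_X subspace_psum)
  have t: "t \<le> s" "dim (y \<inter> x) = s - t" using dim_Int_eq_dist(1,2)[OF y, of x] by (auto simp: t_def)
  have dC: "dim (psum y x) = r + t"
    using dim_psum[of y x] sub t d x by (simp add: mem_X)
  have rt: "r + t \<le> n" unfolding dC[symmetric] n_def by (rule dim_subset) (rule subset_UNIV)
  have srt: "s \<le> r + t"
    using dim_subset[OF psum_upper(1)[OF sub(1,2)]] by (simp add: dC d)
  have "(\<Sum>z | z \<in> X (Suc s) \<and> y \<subseteq> z. l (dist z x))
      = (\<Sum>z | subspace z \<and> y \<subseteq> z \<and> z \<subseteq> UNIV \<and> dim z = Suc s. l (Suc s + t - dim (z \<inter> psum y x)))"
  proof (rule sum.cong)
    fix z assume z: "z \<in> {z. subspace z \<and> y \<subseteq> z \<and> z \<subseteq> UNIV \<and> dim z = Suc s}"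
    then have "dim (z \<inter> psum y x) + dim (x \<inter> y) = s + dim (x \<inter> z)"
      using dim_Int_psum[OF y x, of z] by auto
    moreover have "z \<in> X (Suc s)" using z by (simp add: mem_X)
    ultimately have "dist z x = Suc s + t - dim (z \<inter> psum y x)"
      using dim_Int_eq_dist(1,2)[of z "Suc s" x] t unfolding Int_commute[of x] by linarith
    then show "l (dist z x) = l (Suc s + t - dim (z \<inter> psum y x))" by simp
  qed (auto simp: mem_X)
  also have "\<dots> = (\<Sum>c\<in>{s..Suc s}. meet_count s (r + t) n (Suc s) c * l (Suc s + t - c))"
    using sum_over_meet[of y "psum y x" UNIV "\<lambda>c. l (Suc s + t - c)" "Suc s"] sub psum_upper[of y x]
    by (simp add: dC d n_def del: dim_UNIV)
  also have "{s..Suc s} = {s, Suc s}" by auto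
  also have "(\<Sum>c\<in>{s, Suc s}. meet_count s (r + t) n (Suc s) c * l (Suc s + t - c))
      = q ^ (r + t - s) * ((q ^ (n - (r + t)) - 1) / (q - 1)) * l (Suc t) + (q ^ (r + t - s) - 1) / (q - 1) * l t"
    by (simp add: meet_count_def gbinom_1)
  also have "(q ^ Suc s - q ^ s) * \<dots> = (q ^ s * q ^ (r + t - s)) * (q ^ (n - (r + t)) - 1) * l (Suc t)
      + (q ^ s * q ^ (r + t - s) - q ^ s) * l t"
    by (simp add: divide_simps) (simp add: algebra_simps)
  also have "q ^ s * q ^ (r + t - s) = q ^ (r + t)" using srt by (simp flip: power_add)
  also have "q ^ (r + t) * (q ^ (n - (r + t)) - 1) = q ^ n - q ^ (r + t)"
    using rt by (simp add: algebra_simps flip: power_add)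
  finally show ?thesis by simp
qed

text \<open>A hyperplane \<open>z\<close> of \<open>x1\<close> either contains
  \<open>x1 \<inter> x2\<close>, with distance still \<open>t\<close>, or cuts it in codimension
  one, with distance \<open>t + 1\<close>. The bounds on \<open>t\<close> make this meet nonzero and
  different from \<open>x1\<close>.\<close>

lemma sum_below_one:
  assumes x1: "x1 \<in> X (Suc m)" and x2: "x2 \<in> X r"
  defines "t \<equiv> dist x2 x1"
  assumes t: "t < r" "r - t \<le> m"
  shows "(q - 1) * (\<Sum>z | z \<in> X m \<and> z \<subseteq> x1. l (dist x2 z))
    = (q ^ (Suc m - (r - t)) - 1) * l t + q ^ (Suc m - (r - t)) * (q ^ (r - t) - 1) * l (Suc t)"
proof -
  define g where "g = r - t"
  have sub: "subspace x1" "subspace x2" "subspace (x1 \<inter> x2)" and d: "dim x1 = Suc m"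
    using x1 x2 by (auto simp: mem_X subspace_inter)
  have dC: "dim (x1 \<inter> x2) = g"
    using dim_Int_eq_dist(2)[OF x2, of x1] by (simp add: t_def g_def Int_commute)
  have g: "0 < g" "g \<le> m" "r - (g - 1) = Suc t" "r - g = t" using t by (auto simp: g_def)
  have "(\<Sum>z | z \<in> X m \<and> z \<subseteq> x1. l (dist x2 z))
      = (\<Sum>z | subspace z \<and> {0} \<subseteq> z \<and> z \<subseteq> x1 \<and> dim z = m. l (r - dim (z \<inter> (x1 \<inter> x2))))"
  proof (rule sum.cong)
    fix z assume "z \<in> {z. subspace z \<and> {0} \<subseteq> z \<and> z \<subseteq> x1 \<and> dim z = m}"
    then have "x2 \<inter> z = z \<inter> (x1 \<inter> x2)" by auto
    then show "l (dist x2 z) = l (r - dim (z \<inter> (x1 \<inter> x2)))" using dim_Int_eq_dist(3)[OF x2] by metis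
  qed (auto simp: mem_X subspace_0)
  also have "\<dots> = (\<Sum>c\<in>{0..m}. meet_count 0 g (Suc m) m c * l (r - c))"
    using sum_over_meet[of "{0}" "x1 \<inter> x2" x1 "\<lambda>c. l (r - c)" m] sub by (simp add: subspace_0 dC d)
  also have "\<dots> = (\<Sum>c\<in>{g - 1, g}. meet_count 0 g (Suc m) m c * l (r - c))"
  proof (rule sum.mono_neutral_right)
    show "\<forall>c\<in>{0..m} - {g - 1, g}. meet_count 0 g (Suc m) m c * l (r - c) = 0"
    proof
      fix c assume "c \<in> {0..m} - {g - 1, g}"
      then have "g < c \<or> Suc m - g < m - c" using g by auto
      then show "meet_count 0 g (Suc m) m c * l (r - c) = 0" by (auto simp: meet_count_def gbinom_eq_0)
    qed
  qed (use g in auto)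
  also have "\<dots> = q ^ (Suc m - g) * gbinom g 1 * l (Suc t) + gbinom (Suc m - g) 1 * l t"
  proof -
    have "gbinom g (g - 1) = gbinom g 1" using gbinom_symmetric[of 1 g] g by simp
    moreover have "gbinom (Suc m - g) (m - g) = gbinom (Suc m - g) 1"
      using gbinom_symmetric[of 1 "Suc m - g"] g by (simp add: Suc_diff_le)
    moreover have "m - (g - 1) = Suc m - g" "g - (g - 1) = 1" using g by auto
    ultimately show ?thesis using g by (simp add: meet_count_def mult_ac)
  qed
  finally show ?thesis
    by (simp add: gbinom_1 g_def[symmetric] divide_simps) (simp add: algebra_simps)
qed

end


section \<open>Expansion of kernels\<close>

locale grass_component_maps = finite_field_vector_space scale Basis q
  for scale :: "'k::{field,finite} \<Rightarrow> 'v::ab_group_add \<Rightarrow> 'v" and Basis and q +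
  fixes n :: nat
    and U :: "nat \<Rightarrow> ('i \<Rightarrow> complex) set"
    and \<pi> :: "nat \<Rightarrow> ('v \<Rightarrow> 'v) \<Rightarrow> ('i \<Rightarrow> complex) \<Rightarrow> ('i \<Rightarrow> complex)"
    and W :: "nat \<Rightarrow> nat \<Rightarrow> ('v set \<Rightarrow> complex) set"
    and \<Lambda> :: "nat \<Rightarrow> nat \<Rightarrow> nat \<Rightarrow> ('v set \<Rightarrow> complex) \<Rightarrow> ('v set \<Rightarrow> complex)"
    and \<kappa> :: "nat \<Rightarrow> nat \<Rightarrow> nat \<Rightarrow> nat \<Rightarrow> complex"
  assumes n_eq: "n = dim (UNIV :: 'v set)"
    and decomposition: "grass_decomposition scale n U \<pi> W"
    and \<Lambda>: "\<lbrakk>r1 \<le> n; r2 \<le> n; s \<le> grass_N n r1 r2\<rbrakk> \<Longrightarrow>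
               component_map scale r1 (W r1 s) (W r2 s) (\<Lambda> s r1 r2)"
    and \<kappa>: "\<lbrakk>r1 \<le> n; r2 \<le> n; s \<le> grass_N n r1 r2\<rbrakk> \<Longrightarrow>
               has_kernel scale r1 r2 (\<Lambda> s r1 r2) (\<kappa> s r1 r2)"
begin

abbreviation I :: "nat \<Rightarrow> nat \<Rightarrow> nat set" where "I \<equiv> grass_I n"
abbreviation N :: "nat \<Rightarrow> nat \<Rightarrow> nat" where "N \<equiv> grass_N n"
abbreviation V :: "nat \<Rightarrow> ('v set \<Rightarrow> complex) set" where "V \<equiv> grass_fun scale"
abbreviation inner where "inner \<equiv> grass_inner scale"

definition kop :: "nat \<Rightarrow> nat \<Rightarrow> (nat \<Rightarrow> complex) \<Rightarrow> ('v set \<Rightarrow> complex) \<Rightarrow> ('v set \<Rightarrow> complex)" where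
  "kop r1 r2 g \<phi> = (\<lambda>x2. if x2 \<in> X r2 then \<Sum>x1\<in>X r1. g (dist x2 x1) * \<phi> x1 else 0)"

lemma dist_mem_I': "x1 \<in> X r1 \<Longrightarrow> x2 \<in> X r2 \<Longrightarrow> dist x2 x1 \<in> I r1 r2"
  using dist_mem_I unfolding n_eq .

lemma kop_cong:
  assumes "\<And>t. t \<in> I r1 r2 \<Longrightarrow> g t = h t"
  shows "kop r1 r2 g \<phi> = kop r1 r2 h \<phi>"
  using assms[OF dist_mem_I'] unfolding kop_def by (intro ext if_cong sum.cong refl) simp_all

lemma kop_sum:
  "kop r1 r2 (\<lambda>t. \<Sum>i\<in>J. c i * g i t) \<phi> = (\<lambda>x. \<Sum>i\<in>J. c i * kop r1 r2 (g i) \<phi> x)"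
proof
  fix x
  have "(\<Sum>x1\<in>X r1. (\<Sum>i\<in>J. c i * g i (dist x x1)) * \<phi> x1) = (\<Sum>x1\<in>X r1. \<Sum>i\<in>J. c i * (g i (dist x x1) * \<phi> x1))"
    by (simp add: sum_distrib_right mult.assoc)
  also have "\<dots> = (\<Sum>i\<in>J. \<Sum>x1\<in>X r1. c i * (g i (dist x x1) * \<phi> x1))" by (rule sum.swap)
  finally show "kop r1 r2 (\<lambda>t. \<Sum>i\<in>J. c i * g i t) \<phi> x = (\<Sum>i\<in>J. c i * kop r1 r2 (g i) \<phi> x)"
    by (simp add: kop_def sum_distrib_left)
qed

lemma kop_mem_V: "kop r1 r2 g \<phi> \<in> V r2"
  by (simp add: kop_def grass_fun_def)

section \<open>Components and the maps between them\<close>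

lemma component_subset: "r \<le> n \<Longrightarrow> s \<le> min r (n - r) \<Longrightarrow> W r s \<subseteq> V r"
  and component_orthogonal: "\<lbrakk>r \<le> n; s \<le> min r (n - r); s' \<le> min r (n - r); s \<noteq> s'; \<phi> \<in> W r s; \<psi> \<in> W r s'\<rbrakk>
     \<Longrightarrow> inner r \<phi> \<psi> = 0"
  and component_span: "r \<le> n \<Longrightarrow> cfun.span (\<Union>s\<in>{..min r (n - r)}. W r s) = V r"
  and component_irreducible: "r \<le> n \<Longrightarrow> s \<le> min r (n - r) \<Longrightarrow> irreducible_rep (GL scale) (W r s) grass_action"
proof -
  note D = decomposition[unfolded grass_decomposition_def, THEN conjunct2, THEN conjunct2, THEN spec, THEN mp]
  show "r \<le> n \<Longrightarrow> s \<le> min r (n - r) \<Longrightarrow> W r s \<subseteq> V r"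
    and "r \<le> n \<Longrightarrow> s \<le> min r (n - r) \<Longrightarrow> irreducible_rep (GL scale) (W r s) grass_action"
    using D[THEN conjunct1] by blast+
  show "\<lbrakk>r \<le> n; s \<le> min r (n - r); s' \<le> min r (n - r); s \<noteq> s'; \<phi> \<in> W r s; \<psi> \<in> W r s'\<rbrakk>
     \<Longrightarrow> inner r \<phi> \<psi> = 0"
    using D[THEN conjunct2, THEN conjunct1] by blast
  show "r \<le> n \<Longrightarrow> cfun.span (\<Union>s\<in>{..min r (n - r)}. W r s) = V r"
    by (rule D[THEN conjunct2, THEN conjunct2])
qed

lemma component_subspace: "r \<le> n \<Longrightarrow> s \<le> min r (n - r) \<Longrightarrow> cfun.subspace (W r s)"
  using component_irreducible unfolding irreducible_rep_def group_rep_def by blast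

lemma inner_self_eq_0: "\<phi> \<in> V r \<Longrightarrow> inner r \<phi> \<phi> = 0 \<Longrightarrow> \<phi> = 0"
proof -
  assume \<phi>: "\<phi> \<in> V r" "inner r \<phi> \<phi> = 0"
  have "inner r \<phi> \<phi> = of_real (\<Sum>x\<in>X r. (cmod (\<phi> x))\<^sup>2)"
    unfolding grass_inner_def of_real_sum by (intro sum.cong refl complex_norm_square[symmetric])
  then have "(\<Sum>x\<in>X r. (cmod (\<phi> x))\<^sup>2) = 0" using \<phi>(2) of_real_eq_0_iff by metis
  then have "\<forall>x\<in>X r. (cmod (\<phi> x))\<^sup>2 = 0" by (subst (asm) sum_nonneg_eq_0_iff) auto
  then show "\<phi> = 0" using \<phi>(1) by (auto simp: grass_fun_def fun_eq_iff)
qed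

lemma index_le: "s \<le> N r1 r2 \<Longrightarrow> s \<le> min r1 (n - r1)" "s \<le> N r1 r2 \<Longrightarrow> s \<le> min r2 (n - r2)"
  by (auto simp: grass_N_def)

context
  fixes r1 r2 s
  assumes r: "r1 \<le> n" "r2 \<le> n" and s: "s \<le> N r1 r2"
begin

lemma \<Lambda>_other_component:
  assumes "i \<le> min r1 (n - r1)" "i \<noteq> s" "\<phi> \<in> W r1 i"
  shows "\<Lambda> s r1 r2 \<phi> = 0"
proof -
  have "\<phi> \<in> V r1" using component_subset[OF r(1) assms(1)] assms by blast
  moreover have "\<forall>\<psi>\<in>W r1 s. inner r1 \<phi> \<psi> = 0"
    using component_orthogonal[OF r(1) assms(1) index_le(1)[OF s] assms(2,3)] by blast
  ultimately show ?thesis using \<Lambda>[OF r s] unfolding component_map_def by blast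
qed

lemma \<Lambda>_nonzero: "\<exists>\<phi>\<in>W r1 s. \<Lambda> s r1 r2 \<phi> \<noteq> 0"
  using \<Lambda>[OF r s] unfolding component_map_def by blast

text \<open>\<open>component_map\<close> locates only the image of \<open>W r1 s\<close>. The other
  components go to 0 and all of them together span, so the image of the whole of \<open>V r1\<close>
  is located as well.\<close>

lemma \<Lambda>_mem_component:
  assumes "\<phi> \<in> V r1"
  shows "\<Lambda> s r1 r2 \<phi> \<in> W r2 s"
proof -
  note sub = component_subspace[OF r(2) index_le(2)[OF s]]
  have lin: "\<Lambda> s r1 r2 (\<phi> + \<psi>) = \<Lambda> s r1 r2 \<phi> + \<Lambda> s r1 r2 \<psi>"
    "\<Lambda> s r1 r2 (fscale c \<phi>) = fscale c (\<Lambda> s r1 r2 \<phi>)" if "\<phi> \<in> V r1" "\<psi> \<in> V r1" for \<phi> \<psi> c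
    using \<Lambda>[OF r s] that unfolding component_map_def linear_on_def by blast+
  have Vr: "0 \<in> V r1" "\<And>\<phi> \<psi>. \<phi> \<in> V r1 \<Longrightarrow> \<psi> \<in> V r1 \<Longrightarrow> \<phi> + \<psi> \<in> V r1"
    "\<And>c \<phi>. \<phi> \<in> V r1 \<Longrightarrow> fscale c \<phi> \<in> V r1"
    by (auto simp: grass_fun_def fscale_def)
  have 0: "\<Lambda> s r1 r2 0 = 0"
    using lin(2)[OF Vr(1) Vr(1), of 0] by (simp only: cfun.scale_zero_left)
  have "\<phi> \<in> cfun.span (\<Union>i\<in>{..min r1 (n - r1)}. W r1 i)" using assms component_span[OF r(1)] by simp
  \<comment> \<open>Membership in \<open>V r1\<close> is carried along because linearity is known
    only there.\<close>
  then have "\<phi> \<in> V r1 \<and> \<Lambda> s r1 r2 \<phi> \<in> W r2 s"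
  proof (rule cfun.span_induct)
    show "cfun.subspace {\<phi>. \<phi> \<in> V r1 \<and> \<Lambda> s r1 r2 \<phi> \<in> W r2 s}"
      unfolding cfun.subspace_def using lin Vr 0 cfun.subspace_0[OF sub] cfun.subspace_add[OF sub] cfun.subspace_scale[OF sub]
      by simp
  next
    fix \<phi> assume "\<phi> \<in> (\<Union>i\<in>{..min r1 (n - r1)}. W r1 i)"
    then obtain i where i: "i \<le> min r1 (n - r1)" "\<phi> \<in> W r1 i" by blast
    show "\<phi> \<in> V r1 \<and> \<Lambda> s r1 r2 \<phi> \<in> W r2 s"
    proof (cases "i = s")
      case True
      then show ?thesis using \<Lambda>[OF r s] i component_subset[OF r(1) i(1)]
        unfolding component_map_def equivariant_map_def by blast
    next
      case False
      then show ?thesis using \<Lambda>_other_component[OF i(1) _ i(2)] i component_subset[OF r(1) i(1)] cfun.subspace_0[OF sub]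
        by auto
    qed
  qed
  then show ?thesis ..
qed

text \<open>The kernel fixes the values on \<open>X r2\<close>; off this set both sides are 0, since
  the image lies in \<open>V r2\<close>.\<close>

lemma \<Lambda>_eq_kop:
  assumes "\<phi> \<in> V r1"
  shows "\<Lambda> s r1 r2 \<phi> = kop r1 r2 (\<kappa> s r1 r2) \<phi>"
proof
  fix x
  have "\<Lambda> s r1 r2 \<phi> \<in> V r2" using \<Lambda>_mem_component[OF assms] component_subset[OF r(2) index_le(2)[OF s]] by blast
  then show "\<Lambda> s r1 r2 \<phi> x = kop r1 r2 (\<kappa> s r1 r2) \<phi> x"
    using \<kappa>[OF r s] assms unfolding has_kernel_def kop_def grass_fun_def by simp
qed

end

text \<open>On \<open>W r1 j\<close> every term of the expansion with \<open>i \<noteq> j\<close>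
  vanishes, so restriction to a component isolates one coefficient.\<close>

lemma kop_expansion_on_component:
  assumes r: "r1 \<le> n" "r2 \<le> n" and g: "\<And>t. t \<in> I r1 r2 \<Longrightarrow> g t = (\<Sum>i\<le>N r1 r2. c i * \<kappa> i r1 r2 t)"
    and j: "j \<le> N r1 r2" "\<phi> \<in> W r1 j"
  shows "kop r1 r2 g \<phi> = fscale (c j) (\<Lambda> j r1 r2 \<phi>)"
proof -
  have \<phi>: "\<phi> \<in> V r1" using component_subset[OF r(1) index_le(1)[OF j(1)]] j by blast
  have "kop r1 r2 g \<phi> = kop r1 r2 (\<lambda>t. \<Sum>i\<le>N r1 r2. c i * \<kappa> i r1 r2 t) \<phi>"
    by (rule kop_cong) (rule g)
  also have "\<dots> = (\<lambda>x. \<Sum>i\<le>N r1 r2. c i * kop r1 r2 (\<kappa> i r1 r2) \<phi> x)" by (rule kop_sum)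
  also have "\<dots> = (\<lambda>x. \<Sum>i\<le>N r1 r2. if i = j then c i * \<Lambda> i r1 r2 \<phi> x else 0)"
  proof (intro ext sum.cong refl)
    fix x i assume i: "i \<in> {..N r1 r2}"
    then show "c i * kop r1 r2 (\<kappa> i r1 r2) \<phi> x = (if i = j then c i * \<Lambda> i r1 r2 \<phi> x else 0)"
      using \<Lambda>_eq_kop[OF r, of i \<phi>] \<Lambda>_other_component[OF r, of i j \<phi>] \<phi> j index_le(1)[OF j(1)] by auto
  qed
  also have "\<dots> = fscale (c j) (\<Lambda> j r1 r2 \<phi>)" using j by (simp add: fscale_def)
  finally show ?thesis .
qed

lemma kernels_independent:
  assumes r: "r1 \<le> n" "r2 \<le> n" and 0: "\<And>t. t \<in> I r1 r2 \<Longrightarrow> (\<Sum>i\<le>N r1 r2. c i * \<kappa> i r1 r2 t) = 0"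
    and j: "j \<le> N r1 r2"
  shows "c j = 0"
proof -
  obtain \<phi> where \<phi>: "\<phi> \<in> W r1 j" "\<Lambda> j r1 r2 \<phi> \<noteq> 0" using \<Lambda>_nonzero[OF r j] by blast
  have "kop r1 r2 (\<lambda>_. 0) \<phi> = fscale (c j) (\<Lambda> j r1 r2 \<phi>)"
    by (rule kop_expansion_on_component[OF r _ j \<phi>(1)]) (simp only: 0)
  moreover have "kop r1 r2 (\<lambda>_. 0) \<phi> = 0" by (simp add: kop_def fun_eq_iff)
  ultimately have "fscale (c j) (\<Lambda> j r1 r2 \<phi>) = 0" by simp
  then show ?thesis using \<phi>(2) by (simp add: cfun.scale_eq_0_iff)
qed

text \<open>The kernels of \<open>\<Lambda> i r1 r2\<close> for \<open>i \<le> N r1 r2\<close> are as many as the elements of \<open>I r1 r2\<close>, so by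
  independence they span all kernels; this replaces Schur's lemma.\<close>

lemma kernel_expansion:
  assumes r: "r1 \<le> n" "r2 \<le> n"
  obtains c where "\<And>t. t \<in> I r1 r2 \<Longrightarrow> g t = (\<Sum>i\<le>N r1 r2. c i * \<kappa> i r1 r2 t)"
proof -
  let ?N = "N r1 r2"
  \<comment> \<open>With \<open>g\<close> as an additional member there is one function more than
    points in \<open>I r1 r2\<close>, hence a dependence. By independence of the kernels,
    \<open>g\<close> must occur in it.\<close>
  define A where "A i = (if i \<le> ?N then \<kappa> i r1 r2 else g)" for i
  have "\<exists>c. (\<exists>j\<in>{..Suc ?N}. c j \<noteq> 0) \<and> (\<forall>t\<in>I r1 r2. (\<Sum>j\<in>{..Suc ?N}. c j * A j t) = 0)"
    by (rule homogeneous_system_nontrivial_solution) (simp_all add: r card_grass_I)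
  then obtain c where c: "\<exists>j\<in>{..Suc ?N}. c j \<noteq> 0" "\<And>t. t \<in> I r1 r2 \<Longrightarrow> (\<Sum>j\<in>{..Suc ?N}. c j * A j t) = 0"
    by blast
  have c2: "(\<Sum>j\<le>?N. c j * \<kappa> j r1 r2 t) + c (Suc ?N) * g t = 0" if "t \<in> I r1 r2" for t
    using c(2)[OF that] by (simp add: A_def)
  have "c (Suc ?N) \<noteq> 0"
  proof
    assume 0: "c (Suc ?N) = 0"
    have "c j = 0" if "j \<le> ?N" for j
    proof (rule kernels_independent[OF r _ that])
      fix t assume "t \<in> I r1 r2"
      from c2[OF this] show "(\<Sum>i\<le>?N. c i * \<kappa> i r1 r2 t) = 0" unfolding 0 by simp
    qed
    then show False using 0 c(1) by (auto simp: le_Suc_eq)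
  qed
  then have "g t = (\<Sum>i\<le>?N. - c i / c (Suc ?N) * \<kappa> i r1 r2 t)" if "t \<in> I r1 r2" for t
  proof -
    have "g t * c (Suc ?N) = - (\<Sum>j\<le>?N. c j * \<kappa> j r1 r2 t)"
      using c2[OF that] unfolding add_eq_0_iff by (simp only: mult.commute)
    then have "g t = - (\<Sum>j\<le>?N. c j * \<kappa> j r1 r2 t) / c (Suc ?N)"
      by (simp only: nonzero_eq_divide_eq[OF \<open>c (Suc ?N) \<noteq> 0\<close>])
    then show ?thesis by (simp add: sum_negf sum_divide_distrib)
  qed
  then show ?thesis by (rule that)
qed

text \<open>The hypothesis asks only for orthogonality, so it covers operators that kill the other
  components as well as operators whose image avoids them. For \<open>s > N r1 r2\<close> no term of
  the expansion is left.\<close>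

lemma kernel_single_component:
  assumes r: "r1 \<le> n" "r2 \<le> n"
    and orth: "\<And>j \<phi> \<psi>. \<lbrakk>j \<le> N r1 r2; j \<noteq> s; \<phi> \<in> W r1 j; \<psi> \<in> W r2 j\<rbrakk> \<Longrightarrow> inner r2 (kop r1 r2 g \<phi>) \<psi> = 0"
  obtains c where "\<And>t. t \<in> I r1 r2 \<Longrightarrow> g t = (if s \<le> N r1 r2 then c * \<kappa> s r1 r2 t else 0)"
proof -
  obtain c where c: "\<And>t. t \<in> I r1 r2 \<Longrightarrow> g t = (\<Sum>i\<le>N r1 r2. c i * \<kappa> i r1 r2 t)"
    using kernel_expansion[OF r] by blast
  have c0: "c j = 0" if j: "j \<le> N r1 r2" "j \<noteq> s" for j
  proof -
    obtain \<phi> where \<phi>: "\<phi> \<in> W r1 j" "\<Lambda> j r1 r2 \<phi> \<noteq> 0" using \<Lambda>_nonzero[OF r j(1)] by blast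
    have "\<phi> \<in> V r1" using component_subset[OF r(1) index_le(1)[OF j(1)]] \<phi>(1) by blast
    then have "\<Lambda> j r1 r2 \<phi> \<in> W r2 j" by (rule \<Lambda>_mem_component[OF r j(1)])
    then have "kop r1 r2 g \<phi> \<in> W r2 j"
      using kop_expansion_on_component[OF r c j(1) \<phi>(1)]
        cfun.subspace_scale[OF component_subspace[OF r(2) index_le(2)[OF j(1)]]] by simp
    \<comment> \<open>The image of \<open>\<phi>\<close> lies in \<open>W r2 j\<close> itself, so it
      may be paired with itself.\<close>
    then have "inner r2 (kop r1 r2 g \<phi>) (kop r1 r2 g \<phi>) = 0" using orth[OF j \<phi>(1)] by blast
    then have "kop r1 r2 g \<phi> = 0" by (rule inner_self_eq_0[OF kop_mem_V])
    then have "fscale (c j) (\<Lambda> j r1 r2 \<phi>) = 0" using kop_expansion_on_component[OF r c j(1) \<phi>(1)] by simp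
    then show "c j = 0" using \<phi>(2) by (simp add: cfun.scale_eq_0_iff)
  qed
  have "g t = (if s \<le> N r1 r2 then c s * \<kappa> s r1 r2 t else 0)" if "t \<in> I r1 r2" for t
  proof -
    have "g t = (\<Sum>i\<le>N r1 r2. if i = s then c i * \<kappa> i r1 r2 t else 0)"
      unfolding c[OF that] using c0 by (intro sum.cong) auto
    then show ?thesis by simp
  qed
  then show ?thesis by (rule that)
qed

text \<open>Here \<open>g\<close> is the kernel of \<open>\<Lambda> s r1 r2\<close> followed by
  summation along the relation \<open>E\<close>; the composite kills every \<open>W r1 j\<close>
  with \<open>j \<noteq> s\<close>.\<close>

lemma kernel_of_left_composition:
  assumes r: "r1 \<le> n" "r2 \<le> n" "r3 \<le> n" and s: "s \<le> N r1 r2"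
    and g: "\<And>x x1. x \<in> X r3 \<Longrightarrow> x1 \<in> X r1 \<Longrightarrow> g (dist x x1) = (\<Sum>z | z \<in> X r2 \<and> E x z. \<kappa> s r1 r2 (dist z x1))"
  obtains c where "\<And>t. t \<in> I r1 r3 \<Longrightarrow> g t = (if s \<le> N r1 r3 then c * \<kappa> s r1 r3 t else 0)"
proof (rule kernel_single_component[OF r(1,3)])
  fix j \<phi> \<psi> assume j: "j \<le> N r1 r3" "j \<noteq> s" "\<phi> \<in> W r1 j" "\<psi> \<in> W r3 j"
  have \<phi>: "\<phi> \<in> V r1" using component_subset[OF r(1) index_le(1)[OF j(1)]] j by blast
  have "kop r1 r3 g \<phi> x = 0" for x
  proof (cases "x \<in> X r3")
    case True
    then have "kop r1 r3 g \<phi> x = (\<Sum>x1\<in>X r1. \<Sum>z | z \<in> X r2 \<and> E x z. \<kappa> s r1 r2 (dist z x1) * \<phi> x1)"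
      by (simp add: kop_def g sum_distrib_right)
    also have "\<dots> = (\<Sum>z | z \<in> X r2 \<and> E x z. \<Sum>x1\<in>X r1. \<kappa> s r1 r2 (dist z x1) * \<phi> x1)" by (rule sum.swap)
    also have "\<dots> = (\<Sum>z | z \<in> X r2 \<and> E x z. \<Lambda> s r1 r2 \<phi> z)"
      using \<Lambda>_eq_kop[OF r(1,2) s \<phi>] by (intro sum.cong) (auto simp: kop_def)
    finally show ?thesis using \<Lambda>_other_component[OF r(1,2) s index_le(1)[OF j(1)] j(2,3)] by simp
  qed (simp add: kop_def)
  then show "inner r3 (kop r1 r3 g \<phi>) \<psi> = 0" by (simp add: grass_inner_def)
qed (rule that)

text \<open>Here summation along \<open>E\<close> comes first, so nothing needs to be killed;
  instead the image lies in \<open>W r2 s\<close>, which is orthogonal to the other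
  components.\<close>

lemma kernel_of_right_composition:
  assumes r: "r1 \<le> n" "r2 \<le> n" "r3 \<le> n" and s: "s \<le> N r3 r2"
    and g: "\<And>x1 x2. x1 \<in> X r1 \<Longrightarrow> x2 \<in> X r2 \<Longrightarrow> g (dist x2 x1) = (\<Sum>z | z \<in> X r3 \<and> E x1 z. \<kappa> s r3 r2 (dist x2 z))"
  obtains c where "\<And>t. t \<in> I r1 r2 \<Longrightarrow> g t = (if s \<le> N r1 r2 then c * \<kappa> s r1 r2 t else 0)"
proof (rule kernel_single_component[OF r(1,2)])
  fix j \<phi> \<psi> assume j: "j \<le> N r1 r2" "j \<noteq> s" "\<phi> \<in> W r1 j" "\<psi> \<in> W r2 j"
  \<comment> \<open>The image of \<open>\<phi>\<close> under the incidence operator, to which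
    \<open>\<Lambda> s r3 r2\<close> is then applied.\<close>
  define \<phi>' where "\<phi>' z = (if z \<in> X r3 then \<Sum>x1 | x1 \<in> X r1 \<and> E x1 z. \<phi> x1 else 0)" for z
  have \<phi>': "\<phi>' \<in> V r3" by (simp add: grass_fun_def \<phi>'_def)
  have "kop r1 r2 g \<phi> x = kop r3 r2 (\<kappa> s r3 r2) \<phi>' x" for x
  proof (cases "x \<in> X r2")
    case True
    then have "kop r1 r2 g \<phi> x = (\<Sum>x1\<in>X r1. \<Sum>z\<in>{z \<in> X r3. E x1 z}. \<kappa> s r3 r2 (dist x z) * \<phi> x1)"
      by (simp add: kop_def g sum_distrib_right)
    also have "\<dots> = (\<Sum>z\<in>X r3. \<Sum>x1\<in>{x1 \<in> X r1. E x1 z}. \<kappa> s r3 r2 (dist x z) * \<phi> x1)"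
      by (rule sum.swap_restrict) auto
    finally show ?thesis using True by (simp add: kop_def \<phi>'_def sum_distrib_left)
  qed (simp add: kop_def)
  then have "kop r1 r2 g \<phi> = \<Lambda> s r3 r2 \<phi>'" using \<Lambda>_eq_kop[OF r(3,2) s \<phi>'] by auto
  then have "kop r1 r2 g \<phi> \<in> W r2 s" using \<Lambda>_mem_component[OF r(3,2) s \<phi>'] by simp
  then show "inner r2 (kop r1 r2 g \<phi>) \<psi> = 0"
    using component_orthogonal[OF r(2) index_le(2)[OF s] index_le(2)[OF j(1)]] j by blast
qed (rule that)


section \<open>The kernels to degree \<open>s\<close> and from degree \<open>n - s\<close>\<close>

text \<open>Summing \<open>\<Lambda> s r s \<phi>\<close> over all \<open>z\<close> above a given \<open>(s-1)\<close>-dimensional space gives an equivariant map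
  into a space without the component \<open>s\<close>, hence \<open>0\<close>.\<close>

lemma kernel_recursion_to_degree:
  assumes s: "2 * s \<le> n" "s \<le> r" "r \<le> n - s" and t: "t < s"
  shows "(q ^ (r + t) - q ^ (s - 1)) * \<kappa> s r s t + (q ^ n - q ^ (r + t)) * \<kappa> s r s (Suc t) = 0"
proof -
  obtain m where m: "s = Suc m" using t by (cases s) auto
  have q0: "q ^ s - q ^ m \<noteq> 0" using m by simp
  \<comment> \<open>The right-hand side of \<open>sum_above_one\<close>, divided by its factor: the
    kernel of the composite map into dimension \<open>m = s - 1\<close>.\<close>
  define g where "g t = ((q ^ (r + t) - q ^ m) * \<kappa> s r s t + (q ^ n - q ^ (r + t)) * \<kappa> s r s (Suc t)) / (q ^ s - q ^ m)" for t
  have le: "r \<le> n" "s \<le> n" "m \<le> n" "s \<le> N r s" using s m by (auto simp: grass_N_def)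
  obtain c where c: "\<And>t. t \<in> I r m \<Longrightarrow> g t = (if s \<le> N r m then c * \<kappa> s r m t else 0)"
  proof (rule kernel_of_left_composition[OF le, where E = "\<lambda>y z. y \<subseteq> z"])
    fix y x assume x: "y \<in> X m" "x \<in> X r"
    show "g (dist y x) = (\<Sum>z | z \<in> X s \<and> y \<subseteq> z. \<kappa> s r s (dist z x))"
      using sum_above_one[OF x, of "\<kappa> s r s", symmetric]
      unfolding g_def nonzero_divide_eq_eq[OF q0] n_eq[symmetric] m[symmetric]
      by (simp only: mult.commute[of _ "q ^ s - q ^ m"])
  qed auto
  have "t \<in> I r m" using s m t by (subst grass_I_eq) auto
  moreover have "\<not> s \<le> N r m" using m by (simp add: grass_N_def)
  ultimately have "g t = 0" using c by simp
  then show ?thesis using q0 by (simp add: g_def m)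
qed

text \<open>Dually, \<open>\<Lambda> s (n - s) r\<close> is precomposed with a map from functions in dimension \<open>n - s + 1\<close>.\<close>

lemma kernel_recursion_from_codegree:
  assumes s: "2 * s \<le> n" "s \<le> r" "r \<le> n - s" and t: "t < s"
  defines "e \<equiv> Suc (n - s) - (r - t)"
  shows "(q ^ e - 1) * \<kappa> s (n - s) r t + q ^ e * (q ^ (r - t) - 1) * \<kappa> s (n - s) r (Suc t) = 0"
proof -
  define m where "m = n - s"
  define g where "g t = ((q ^ (Suc m - (r - t)) - 1) * \<kappa> s m r t
      + q ^ (Suc m - (r - t)) * (q ^ (r - t) - 1) * \<kappa> s m r (Suc t)) / (q - 1)" for t
  have q0: "q - 1 \<noteq> 0" by simp
  have le: "Suc m \<le> n" "r \<le> n" "m \<le> n" "s \<le> N m r" using s t by (auto simp: grass_N_def m_def)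
  \<comment> \<open>The index set consists of exactly the \<open>t < s\<close>. This also yields the
    two bounds that \<open>sum_below_one\<close> requires.\<close>
  have I: "I (Suc m) r = {..s - 1}" using s t by (subst grass_I_eq) (auto simp: m_def)
  obtain c where c: "\<And>t. t \<in> I (Suc m) r \<Longrightarrow> g t = (if s \<le> N (Suc m) r then c * \<kappa> s (Suc m) r t else 0)"
  proof (rule kernel_of_right_composition[OF le, where E = "\<lambda>x z. z \<subseteq> x"])
    fix x1 x2 assume x: "x1 \<in> X (Suc m)" "x2 \<in> X r"
    have "dist x2 x1 \<in> I (Suc m) r" using dist_mem_I'[OF x] .
    then have "dist x2 x1 < r" "r - dist x2 x1 \<le> m" using I s t by (auto simp: m_def)
    from sum_below_one[OF x this, of "\<kappa> s m r", symmetric]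
    show "g (dist x2 x1) = (\<Sum>z | z \<in> X m \<and> z \<subseteq> x1. \<kappa> s m r (dist x2 z))"
      unfolding g_def nonzero_divide_eq_eq[OF q0] by (simp only: mult.commute[of _ "q - 1"])
  qed auto
  have "t \<in> I (Suc m) r" using t I by auto
  moreover have "\<not> s \<le> N (Suc m) r" using s t by (auto simp: grass_N_def m_def)
  ultimately have "g t = 0" using c by simp
  then show ?thesis by (simp add: g_def e_def m_def)
qed

section \<open>Closed forms and nonvanishing\<close>

lemma q_power_mult_powi: "q ^ a * q powi (int b - int a) = q ^ b"
  by (simp add: power_int_diff)

lemma mult_one_minus: "c * ((1 - x) * k) = (c - c * x) * k" for c x k :: complex
  by (simp add: algebra_simps)

text \<open>Dividing the recursion by \<open>q ^ (r + t)\<close> turns its two coefficients into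
  factors of shifted factorials with base \<open>inverse q\<close>. No denominator vanishes because
  \<open>r + t < n\<close> for \<open>t < s\<close>.\<close>

lemma kernel_to_degree:
  assumes s: "2 * s \<le> n" "s \<le> r" "r \<le> n - s" and t: "t \<le> s"
  shows "\<kappa> s r s t = qpoch (q powi (int s - int r - 1)) (inverse q) t / qpoch (q ^ (n - r)) (inverse q) t * \<kappa> s r s 0"
proof (rule two_term_recursion[OF _ _ t])
  fix t assume t: "t < s"
  have e: "q ^ (r + t) * (inverse q ^ t * q ^ (n - r)) = q ^ n"
  proof -
    have "q ^ (r + t) * (inverse q ^ t * q ^ (n - r)) = q ^ r * q ^ (n - r)"
      by (simp add: power_add power_inverse)
    also have "\<dots> = q ^ n" unfolding power_add[symmetric] using s by simp
    finally show ?thesis .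
  qed
  have a: "q ^ (r + t) * (inverse q ^ t * q powi (int s - int r - 1)) = q ^ (s - 1)"
  proof -
    have i: "int s - int r - 1 = int (s - 1) - int r" using t by auto
    have "q ^ (r + t) * (inverse q ^ t * q powi (int s - int r - 1)) = q ^ r * q powi (int s - int r - 1)"
      by (simp add: power_add power_inverse)
    then show ?thesis unfolding i q_power_mult_powi .
  qed
  have "q ^ (r + t) * (1 - inverse q ^ t * q ^ (n - r)) = q ^ (r + t) - q ^ n"
    unfolding right_diff_distrib e by simp
  moreover have "q ^ (r + t) \<noteq> q ^ n" using s t by simp
  ultimately show "1 - inverse q ^ t * q ^ (n - r) \<noteq> 0" by (metis mult_zero_right right_minus_eq)
  have "q ^ (r + t) * ((1 - inverse q ^ t * q ^ (n - r)) * \<kappa> s r s (Suc t)) = (q ^ (r + t) - q ^ n) * \<kappa> s r s (Suc t)"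
    by (simp only: mult_one_minus e)
  also have "\<dots> = (q ^ (r + t) - q ^ (s - 1)) * \<kappa> s r s t"
    using kernel_recursion_to_degree[OF s t] by (simp add: algebra_simps)
  also have "\<dots> = q ^ (r + t) * ((1 - inverse q ^ t * q powi (int s - int r - 1)) * \<kappa> s r s t)"
    by (simp only: mult_one_minus a)
  finally show "(1 - inverse q ^ t * q ^ (n - r)) * \<kappa> s r s (Suc t)
      = (1 - inverse q ^ t * q powi (int s - int r - 1)) * \<kappa> s r s t" by simp
qed

text \<open>Now the division is by \<open>q ^ e\<close>, whose inverse is
  \<open>inverse q ^ t * q powi (r + s - n - 1)\<close>; the other coefficient already has the
  required form.\<close>

lemma kernel_from_codegree:
  assumes s: "2 * s \<le> n" "s \<le> r" "r \<le> n - s" and t: "t \<le> s"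
  shows "\<kappa> s (n - s) r t =
    qpoch (q powi (int r + int s - int n - 1)) (inverse q) t / qpoch (q ^ r) (inverse q) t * \<kappa> s (n - s) r 0"
proof (rule two_term_recursion[OF _ _ t])
  fix t assume t: "t < s"
  define e where "e = Suc (n - s) - (r - t)"
  have f: "inverse q ^ t * q ^ r = q ^ (r - t)" using s t by (intro inverse_power_mult) auto
  show "1 - inverse q ^ t * q ^ r \<noteq> 0" using s t q_power_inj[of "r - t" 0] by (simp add: f)
  have a: "q ^ e * (inverse q ^ t * q powi (int r + int s - int n - 1)) = 1"
  proof -
    have i: "int r + int s - int n - 1 = int t - int e" using s t by (simp add: e_def)
    have "inverse q ^ t * (q ^ e * q powi (int t - int e)) = 1"
      unfolding q_power_mult_powi by (simp add: power_inverse)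
    then show ?thesis unfolding i by (simp only: mult.left_commute)
  qed
  have "q ^ e * ((1 - inverse q ^ t * q ^ r) * \<kappa> s (n - s) r (Suc t)) = (q ^ e - 1) * \<kappa> s (n - s) r t"
    using kernel_recursion_from_codegree[OF s t] unfolding f e_def[symmetric] by (simp add: algebra_simps)
  also have "\<dots> = q ^ e * ((1 - inverse q ^ t * q powi (int r + int s - int n - 1)) * \<kappa> s (n - s) r t)"
    by (simp only: mult_one_minus a)
  finally show "(1 - inverse q ^ t * q ^ r) * \<kappa> s (n - s) r (Suc t)
      = (1 - inverse q ^ t * q powi (int r + int s - int n - 1)) * \<kappa> s (n - s) r t" by simp
qed

lemma kernel_nonzero:
  assumes r: "r1 \<le> n" "r2 \<le> n" and s: "s \<le> N r1 r2"
  shows "\<exists>t\<in>I r1 r2. \<kappa> s r1 r2 t \<noteq> 0"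
proof (rule ccontr)
  assume *: "\<not> ?thesis"
  \<comment> \<open>The coefficients are the indicator of \<open>s\<close>: a kernel vanishing on
    \<open>I r1 r2\<close> would be a nontrivial dependence.\<close>
  have "(if s = s then 1 else 0 :: complex) = 0"
    by (rule kernels_independent[OF r _ s, of "\<lambda>i. if i = s then 1 else 0"]) (use * s in \<open>simp add: if_distrib[of "\<lambda>c. c * _"] cong: if_cong\<close>)
  then show False by simp
qed

text \<open>If the value at 0 vanished, the closed form would annihilate the kernel on all of
  \<open>I r s\<close>.\<close>

lemma kernel_to_degree_0:
  assumes s: "2 * s \<le> n" "s \<le> r" "r \<le> n - s"
  shows "\<kappa> s r s 0 \<noteq> 0"
proof
  assume 0: "\<kappa> s r s 0 = 0"
  have r: "r \<le> n" "s \<le> n" "s \<le> N r s" using s by (auto simp: grass_N_def)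
  obtain t where "t \<in> I r s" "\<kappa> s r s t \<noteq> 0" using kernel_nonzero[OF r] by blast
  moreover from this have "t \<le> s" using r by (simp add: grass_I_eq)
  ultimately show False using kernel_to_degree[OF s, of t] 0 by simp
qed

lemma kernel_from_codegree_0:
  assumes s: "2 * s \<le> n" "s \<le> r" "r \<le> n - s"
  shows "\<kappa> s (n - s) r 0 \<noteq> 0"
proof
  assume 0: "\<kappa> s (n - s) r 0 = 0"
  have r: "n - s \<le> n" "r \<le> n" "s \<le> N (n - s) r" using s by (auto simp: grass_N_def)
  obtain t where "t \<in> I (n - s) r" "\<kappa> s (n - s) r t \<noteq> 0" using kernel_nonzero[OF r] by blast
  moreover from this have "t \<le> s" using r s by (simp add: grass_I_eq)
  ultimately show False using kernel_from_codegree[OF s, of t] 0 by simp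
qed


section \<open>Kernel polynomials\<close>

text \<open>The bridge from the closed formula to the counts: the right-hand side is the sum of
  \<open>sum_below\<close> for \<open>b = r2\<close> and that of \<open>sum_above\<close> for
  \<open>b = n - r1\<close>.\<close>

lemma kernel_sum_at_power:
  assumes "t \<le> b" "s \<le> b"
  shows "kernel_sum q s b l (q powi (- int t))
    = (\<Sum>k\<le>s. gbinom (b - t) (s - k) * gbinom t k * q ^ (k * (b - t - (s - k))) * l k)"
proof -
  have u: "q ^ b * q powi (- int t) = q ^ (b - t)" "inverse (q powi (- int t)) = q ^ t"
    using assms by (simp_all add: power_int_minus power_diff divide_inverse)
  show ?thesis unfolding kernel_sum_def u
  proof (rule sum.cong)
    fix k assume k: "k \<in> {..s}"
    define c where "c = (q powi (- int t)) ^ k * q powi (int k * (int b - int s + int k)) * l k"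
    have "qpoch (q ^ (b - t)) (inverse q) (s - k) * qpoch (q ^ t) (inverse q) k * (q powi (- int t)) ^ k
        / (qpoch (q ^ (s - k)) (inverse q) (s - k) * qpoch (q ^ k) (inverse q) k)
        * q powi (int k * (int b - int s + int k)) * l k = gbinom (b - t) (s - k) * gbinom t k * c"
      by (simp add: gbinom_def c_def)
    also have "\<dots> = gbinom (b - t) (s - k) * gbinom t k * (q ^ (k * (b - t - (s - k))) * l k)"
    \<comment> \<open>The natural exponent agrees with the integer one only in the first case; in
      the other one the first binomial coefficient is 0.\<close>
    proof (cases "s - k \<le> b - t")
      case True
      have "- int t * int k + int k * (int b - int s + int k) = int k * (int b - int t - (int s - int k))"
        by (simp add: algebra_simps)
      also have "int b - int t - (int s - int k) = int (b - t - (s - k))" using True k assms by auto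
      finally have e: "- int t * int k + int k * (int b - int s + int k) = int (k * (b - t - (s - k)))" by simp
      have "(q powi (- int t)) ^ k * q powi (int k * (int b - int s + int k))
          = q powi (- int t * int k + int k * (int b - int s + int k))"
        by (simp only: power_int_power' power_int_add[OF disjI1[OF q_nonzero]])
      also have "\<dots> = q ^ (k * (b - t - (s - k)))" unfolding e by (rule power_int_of_nat)
      finally show ?thesis by (simp add: c_def)
    qed (simp add: gbinom_eq_0)
    finally show "qpoch (q ^ (b - t)) (inverse q) (s - k) * qpoch (q ^ t) (inverse q) k * (q powi (- int t)) ^ k
        / (qpoch (q ^ (s - k)) (inverse q) (s - k) * qpoch (q ^ k) (inverse q) k)
        * q powi (int k * (int b - int s + int k)) * l k
      = gbinom (b - t) (s - k) * gbinom t k * q ^ (k * (b - t - (s - k))) * l k"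
      by (simp only: mult.assoc)
  qed simp
qed

lemma kernel_sum_at_1_nonzero:
  assumes "s \<le> b" "l 0 \<noteq> 0"
  shows "kernel_sum q s b l 1 \<noteq> 0"
  using assms by (simp add: kernel_sum_at_1 qpoch_power_nonzero)

context
  fixes r1 r2 s
  assumes r: "r1 \<le> n" "r2 \<le> n" and s: "s \<le> N r1 r2"
begin

lemma index_bounds:
  "2 * s \<le> n" "s \<le> r1" "s \<le> r2" "s \<le> n - r1" "s \<le> n - r2" "r1 \<le> n - s" "r2 \<le> n - s" "s \<le> n"
  using s r by (auto simp: grass_N_def)

lemma mem_I_bounds: "t \<in> I r1 r2 \<Longrightarrow> t \<le> r2 \<and> t \<le> n - r1"
  by (simp add: grass_I_eq r)

text \<open>The sum is the kernel of \<open>\<Lambda> s r1 s\<close> followed by summation over the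
  \<open>s\<close>-dimensional subspaces of \<open>x2\<close>. At this stage \<open>c = 0\<close> is
  not excluded.\<close>

lemma kernel_sum_left:
  "\<exists>c. \<forall>t\<in>I r1 r2. kernel_sum q s r2 (\<kappa> s r1 s) (q powi (- int t)) = c * \<kappa> s r1 r2 t"
proof -
  have le: "r1 \<le> n" "s \<le> n" "r2 \<le> n" "s \<le> N r1 s" using r s index_bounds by (auto simp: grass_N_def)
  obtain c where c: "\<And>t. t \<in> I r1 r2 \<Longrightarrow>
      kernel_sum q s r2 (\<kappa> s r1 s) (q powi (- int t)) = (if s \<le> N r1 r2 then c * \<kappa> s r1 r2 t else 0)"
  proof (rule kernel_of_left_composition[OF le, where E = "\<lambda>x y. y \<subseteq> x"])
    fix x2 x1 assume x: "x2 \<in> X r2" "x1 \<in> X r1"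
    have "dist x2 x1 \<le> r2" using mem_I_bounds dist_mem_I'[OF x(2,1)] by blast
    then show "kernel_sum q s r2 (\<kappa> s r1 s) (q powi (- int (dist x2 x1)))
        = (\<Sum>y | y \<in> X s \<and> y \<subseteq> x2. \<kappa> s r1 s (dist y x1))"
      unfolding sum_below[OF x(2,1)] by (rule kernel_sum_at_power) (rule index_bounds)
  qed auto
  then show ?thesis using s by auto
qed

text \<open>The sum is the kernel of the incidence map from dimension \<open>r1\<close> up to
  \<open>n - s\<close>, followed by \<open>\<Lambda> s (n - s) r2\<close>.\<close>

lemma kernel_sum_right:
  "\<exists>c. \<forall>t\<in>I r1 r2. kernel_sum q s (n - r1) (\<kappa> s (n - s) r2) (q powi (- int t)) = c * \<kappa> s r1 r2 t"
proof -
  have le: "r1 \<le> n" "r2 \<le> n" "n - s \<le> n" "s \<le> N (n - s) r2" using r s index_bounds by (auto simp: grass_N_def)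
  obtain c where c: "\<And>t. t \<in> I r1 r2 \<Longrightarrow>
      kernel_sum q s (n - r1) (\<kappa> s (n - s) r2) (q powi (- int t)) = (if s \<le> N r1 r2 then c * \<kappa> s r1 r2 t else 0)"
  proof (rule kernel_of_right_composition[OF le, where E = "\<lambda>x z. x \<subseteq> z"])
    fix x1 x2 assume x: "x1 \<in> X r1" "x2 \<in> X r2"
    have "dist x2 x1 \<le> n - r1" using mem_I_bounds dist_mem_I'[OF x] by blast
    then show "kernel_sum q s (n - r1) (\<kappa> s (n - s) r2) (q powi (- int (dist x2 x1)))
        = (\<Sum>z | z \<in> X (n - s) \<and> x1 \<subseteq> z. \<kappa> s (n - s) r2 (dist x2 z))"
      using sum_above[OF x, of s "\<kappa> s (n - s) r2"] unfolding n_eq[symmetric]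
      by (simp only: index_bounds kernel_sum_at_power)
  qed auto
  then show ?thesis using s by auto
qed

section \<open>Existence and uniqueness of the kernel polynomial\<close>

lemma power_int_inj: "inj_on (\<lambda>t. q powi (- int t)) A"
  by (rule inj_onI) (simp add: power_int_minus)

text \<open>There are \<open>N r1 r2 + 1 > s\<close> distinct interpolation points.\<close>

lemma poly_eq_on_I:
  assumes "degree p \<le> s" "degree p' \<le> s"
    and "\<And>t. t \<in> I r1 r2 \<Longrightarrow> poly p (q powi (- int t)) = poly p' (q powi (- int t))"
  shows "p = p'"
proof (rule poly_eqI_degree)
  have "card ((\<lambda>t. q powi (- int t)) ` I r1 r2) = Suc (N r1 r2)"
    using card_image[OF power_int_inj] card_grass_I[OF r] by simp
  then show "degree p < card ((\<lambda>t. q powi (- int t)) ` I r1 r2)" "degree p' < card ((\<lambda>t. q powi (- int t)) ` I r1 r2)"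
    using assms(1,2) s by simp_all
qed (use assms(3) in auto)

lemma is_kernel_poly_unique:
  "is_kernel_poly q n s r1 r2 (\<kappa> s r1 r2) p \<Longrightarrow> is_kernel_poly q n s r1 r2 (\<kappa> s r1 r2) p' \<Longrightarrow> p = p'"
  unfolding is_kernel_poly_def by (rule poly_eq_on_I) auto

text \<open>If \<open>c\<close> were 0, the polynomial of the kernel sum would vanish at all
  interpolation points and hence be 0, against its value at 1. The detour through the polynomial
  matters, as 1 is an interpolation point only for \<open>r2 \<le> r1\<close>.\<close>

lemma kernel_poly_from_sum:
  assumes eq: "\<forall>t\<in>I r1 r2. kernel_sum q s b l (q powi (- int t)) = c * \<kappa> s r1 r2 t"
    and b: "s \<le> b" "l 0 \<noteq> 0"
  shows "\<exists>p. is_kernel_poly q n s r1 r2 (\<kappa> s r1 r2) p \<and> (\<exists>c1. c1 \<noteq> 0 \<and> (\<forall>u. u \<noteq> 0 \<longrightarrow> poly p u = c1 * kernel_sum q s b l u))"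
proof -
  obtain P where P: "degree P \<le> s" "\<And>u. u \<noteq> 0 \<Longrightarrow> poly P u = kernel_sum q s b l u"
    using kernel_sum_polynomial by metis
  have PI: "poly P (q powi (- int t)) = c * \<kappa> s r1 r2 t" if "t \<in> I r1 r2" for t
    using P(2)[of "q powi (- int t)"] eq that by simp
  have "c \<noteq> 0"
  proof
    assume "c = 0"
    then have "P = 0" using PI by (intro poly_eq_on_I P) auto
    then show False using P(2)[of 1] kernel_sum_at_1_nonzero[of s b l] b by simp
  qed
  then have "is_kernel_poly q n s r1 r2 (\<kappa> s r1 r2) (smult (inverse c) P)"
    using P(1) PI by (simp add: is_kernel_poly_def)
  moreover have "\<forall>u. u \<noteq> 0 \<longrightarrow> poly (smult (inverse c) P) u = inverse c * kernel_sum q s b l u"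
    using P(2) by simp
  ultimately show ?thesis using \<open>c \<noteq> 0\<close> by (intro exI[of _ "smult (inverse c) P"] conjI exI[of _ "inverse c"]) auto
qed

abbreviation "F \<equiv> kernel_poly q n s r1 r2 (\<kappa> s r1 r2)"

lemma kernel_poly_ex1: "\<exists>!p. is_kernel_poly q n s r1 r2 (\<kappa> s r1 r2) p"
  and kernel_poly_left: "\<exists>c1. c1 \<noteq> 0 \<and> (\<forall>u. u \<noteq> 0 \<longrightarrow> poly F u = c1 * kernel_sum q s r2 (\<kappa> s r1 s) u)"
  and kernel_poly_right: "\<exists>c2. c2 \<noteq> 0 \<and> (\<forall>u. u \<noteq> 0 \<longrightarrow> poly F u = c2 * kernel_sum q s (n - r1) (\<kappa> s (n - s) r2) u)"
proof -
  obtain c where c: "\<forall>t\<in>I r1 r2. kernel_sum q s r2 (\<kappa> s r1 s) (q powi (- int t)) = c * \<kappa> s r1 r2 t"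
    using kernel_sum_left by blast
  obtain c' where c': "\<forall>t\<in>I r1 r2. kernel_sum q s (n - r1) (\<kappa> s (n - s) r2) (q powi (- int t)) = c' * \<kappa> s r1 r2 t"
    using kernel_sum_right by blast
  have nz: "\<kappa> s r1 s 0 \<noteq> 0" "\<kappa> s (n - s) r2 0 \<noteq> 0"
    using kernel_to_degree_0 kernel_from_codegree_0 index_bounds by blast+
  obtain p c1 where p: "is_kernel_poly q n s r1 r2 (\<kappa> s r1 r2) p" "c1 \<noteq> 0"
      "\<forall>u. u \<noteq> 0 \<longrightarrow> poly p u = c1 * kernel_sum q s r2 (\<kappa> s r1 s) u"
    using kernel_poly_from_sum[OF c index_bounds(3) nz(1)] by blast
  obtain p' c2 where p': "is_kernel_poly q n s r1 r2 (\<kappa> s r1 r2) p'" "c2 \<noteq> 0"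
      "\<forall>u. u \<noteq> 0 \<longrightarrow> poly p' u = c2 * kernel_sum q s (n - r1) (\<kappa> s (n - s) r2) u"
    using kernel_poly_from_sum[OF c' index_bounds(4) nz(2)] by blast
  show ex1: "\<exists>!p. is_kernel_poly q n s r1 r2 (\<kappa> s r1 r2) p"
    using p(1) is_kernel_poly_unique by blast
  have F: "F = p" "F = p'"
    unfolding kernel_poly_def using the1_equality[OF ex1] p(1) p'(1) by blast+
  show "\<exists>c1. c1 \<noteq> 0 \<and> (\<forall>u. u \<noteq> 0 \<longrightarrow> poly F u = c1 * kernel_sum q s r2 (\<kappa> s r1 s) u)"
    unfolding F(1) using p by blast
  show "\<exists>c2. c2 \<noteq> 0 \<and> (\<forall>u. u \<noteq> 0 \<longrightarrow> poly F u = c2 * kernel_sum q s (n - r1) (\<kappa> s (n - s) r2) u)"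
    unfolding F(2) using p' by blast
qed

lemma is_kernel_poly_F: "is_kernel_poly q n s r1 r2 (\<kappa> s r1 r2) F"
  unfolding kernel_poly_def by (rule theI'[OF kernel_poly_ex1])

section \<open>Special values and behaviour under conjugation\<close>

lemma poly_F: "t \<in> I r1 r2 \<Longrightarrow> poly F (q powi (- int t)) = \<kappa> s r1 r2 t"
  and degree_F_le: "degree F \<le> s"
  using is_kernel_poly_F by (auto simp: is_kernel_poly_def)

lemma poly_F_1_nonzero: "poly F 1 \<noteq> 0"
proof -
  obtain c1 where "c1 \<noteq> 0" "\<forall>u. u \<noteq> 0 \<longrightarrow> poly F u = c1 * kernel_sum q s r2 (\<kappa> s r1 s) u"
    using kernel_poly_left by blast
  then show ?thesis
    using kernel_sum_at_1_nonzero[of s r2 "\<kappa> s r1 s"] index_bounds kernel_to_degree_0[of s r1] by simp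
qed

lemma F_nonzero: "F \<noteq> 0"
  using poly_F_1_nonzero by auto

text \<open>At both points the left kernel sum reduces to one term, and these terms share their
  nonzero prefactor.\<close>

lemma poly_F_ratio_left: "poly F (q powi (- int r2)) / poly F 1 = \<kappa> s r1 s s / \<kappa> s r1 s 0"
proof -
  obtain c1 where c1: "c1 \<noteq> 0" "\<And>u. u \<noteq> 0 \<Longrightarrow> poly F u = c1 * kernel_sum q s r2 (\<kappa> s r1 s) u"
    using kernel_poly_left by blast
  show ?thesis
    using c1(1) index_bounds(3) qpoch_power_nonzero[of s r2] qpoch_power_nonzero[of s s] c1(2)[of 1] c1(2)[of "q powi (- int r2)"]
    by (simp add: kernel_sum_at_1 kernel_sum_at_zero_of_qpoch)
qed

lemma poly_F_ratio_right: "poly F (q powi (int r1 - int n)) / poly F 1 = \<kappa> s (n - s) r2 s / \<kappa> s (n - s) r2 0"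
proof -
  obtain c1 where c1: "c1 \<noteq> 0" "\<And>u. u \<noteq> 0 \<Longrightarrow> poly F u = c1 * kernel_sum q s (n - r1) (\<kappa> s (n - s) r2) u"
    using kernel_poly_right by blast
  have e: "int r1 - int n = - int (n - r1)" using r by simp
  show ?thesis unfolding e
    using c1(1) index_bounds(4) qpoch_power_nonzero[of s "n - r1"] qpoch_power_nonzero[of s s] c1(2)[of 1] c1(2)[of "q powi (- int (n - r1))"]
    by (simp add: kernel_sum_at_1 kernel_sum_at_zero_of_qpoch del: of_nat_diff)
qed

lemma kernel_ratio_to_degree: "\<kappa> s r1 s s / \<kappa> s r1 s 0 = (- 1) ^ s * q powi (int (s choose 2) - int r1 * int s)
    * (qpoch (q ^ r1) (inverse q) s / qpoch (q ^ (n - r1)) (inverse q) s)"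
  using kernel_to_degree[of s r1 s] kernel_to_degree_0[of s r1] index_bounds
  by (simp add: qpoch_reverse)

lemma kernel_ratio_from_codegree: "\<kappa> s (n - s) r2 s / \<kappa> s (n - s) r2 0
    = (- 1) ^ s * q powi (int (s choose 2) + int s * (int r2 - int n))
    * (qpoch (q ^ (n - r2)) (inverse q) s / qpoch (q ^ r2) (inverse q) s)"
proof -
  have e: "int r2 + int s - int n - 1 = int s - int (n - r2) - 1"
    "int (s choose 2) + int s * (int r2 - int n) = int (s choose 2) - int (n - r2) * int s"
    using r by (simp_all add: algebra_simps)
  show ?thesis
    using kernel_from_codegree[of s r2 s] kernel_from_codegree_0[of s r2] index_bounds
    unfolding e qpoch_reverse[OF q_nonzero] by simp
qed

text \<open>As \<open>q\<close> is real, the kernel to degree \<open>s\<close> is a real multiple of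
  its value at 0, and the other factors of the kernel sum are real for real \<open>u\<close>. So
  conjugation multiplies by a constant, which is read off at 1.\<close>

lemma cnj_poly_F:
  assumes "u \<in> \<real>" "u \<noteq> 0"
  shows "cnj (poly F u) = cnj (poly F 1) / poly F 1 * poly F u"
proof -
  have q: "q \<in> \<real>" by (simp add: q_eq)
  let ?l = "\<kappa> s r1 s"
  obtain c1 where c1: "c1 \<noteq> 0" "\<And>u. u \<noteq> 0 \<Longrightarrow> poly F u = c1 * kernel_sum q s r2 ?l u"
    using kernel_poly_left by blast
  have l0: "?l 0 \<noteq> 0" using kernel_to_degree_0 index_bounds by blast
  have "cnj (?l k) = cnj (?l 0) / ?l 0 * ?l k" if "k \<le> s" for k
  proof -
    define A where "A = qpoch (q powi (int s - int r1 - 1)) (inverse q) k / qpoch (q ^ (n - r1)) (inverse q) k"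
    have "?l k = A * ?l 0" unfolding A_def by (rule kernel_to_degree[OF index_bounds(1,2,6) that])
    moreover have "cnj A = A" using q by (simp add: A_def cnj_qpoch cnj_power_int Reals_cnj_iff)
    ultimately show ?thesis using l0 by simp
  qed
  then have "kernel_sum q s r2 (\<lambda>k. cnj (?l k)) v = cnj (?l 0) / ?l 0 * kernel_sum q s r2 ?l v" for v
    unfolding kernel_sum_scale[symmetric] by (rule kernel_sum_cong)
  then have e: "cnj (poly F v) = cnj c1 / c1 * (cnj (?l 0) / ?l 0) * poly F v" if "v \<in> \<real>" "v \<noteq> 0" for v
    using c1 cnj_kernel_sum[OF q that(1)] that by simp
  have "cnj (poly F 1) / poly F 1 = cnj c1 / c1 * (cnj (?l 0) / ?l 0)"
    using e[of 1] poly_F_1_nonzero by simp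
  with e[OF assms] show ?thesis by simp
qed

end

lemma degree_kernel_poly:
  assumes r: "r1 \<le> n" "r2 \<le> n" and s: "s \<le> N r1 r2"
  shows "degree (kernel_poly q n s r1 r2 (\<kappa> s r1 r2)) = s"
proof (rule antisym)
  show "degree (kernel_poly q n s r1 r2 (\<kappa> s r1 r2)) \<le> s" by (rule degree_F_le[OF r s])
  show "s \<le> degree (kernel_poly q n s r1 r2 (\<kappa> s r1 r2))"
  proof (rule ccontr)
    assume *: "\<not> ?thesis"
    \<comment> \<open>Otherwise \<open>G 0, \<dots>, G s\<close> are linearly dependent for dimension reasons.\<close>
    define G where "G i = kernel_poly q n i r1 r2 (\<kappa> i r1 r2)" for i
    have degG: "degree (G i) < s" if "i \<le> s" for i
    proof (cases "i = s")
      case False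
      then show ?thesis using degree_F_le[OF r, of i] that s by (simp add: G_def)
    qed (use * in \<open>simp add: G_def\<close>)
    have "\<exists>c. (\<exists>j\<in>{..s}. c j \<noteq> 0) \<and> (\<forall>t\<in>{..<s}. (\<Sum>j\<in>{..s}. c j * coeff (G j) t) = 0)"
      by (rule homogeneous_system_nontrivial_solution) auto
    then obtain c where c: "\<exists>j\<in>{..s}. c j \<noteq> 0" "\<And>t. t < s \<Longrightarrow> (\<Sum>j\<le>s. c j * coeff (G j) t) = 0"
      by auto
    have "(\<Sum>j\<le>s. smult (c j) (G j)) = 0"
    proof (rule poly_eqI)
      fix t
      show "coeff (\<Sum>j\<le>s. smult (c j) (G j)) t = coeff 0 t"
        using c(2)[of t] degG by (cases "t < s") (auto simp: coeff_sum intro!: sum.neutral coeff_eq_0 less_le_trans[OF degG])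
    qed
    then have P: "(\<Sum>j\<le>s. c j * poly (G j) u) = 0" for u
      by (metis (no_types, lifting) poly_0 poly_smult poly_sum sum.cong)
    \<comment> \<open>Extended by zero, the coefficients give a dependence among all the kernels,
      because evaluation at the interpolation points turns each polynomial into its kernel.\<close>
    have "(if j \<le> s then c j else 0) = 0" if "j \<le> N r1 r2" for j
    proof (rule kernels_independent[OF r _ that])
      fix t assume t: "t \<in> I r1 r2"
      have "(\<Sum>i\<le>N r1 r2. (if i \<le> s then c i else 0) * \<kappa> i r1 r2 t) = (\<Sum>i\<le>s. c i * \<kappa> i r1 r2 t)"
        using s by (intro sum.mono_neutral_cong_right) auto
      also have "\<dots> = (\<Sum>i\<le>s. c i * poly (G i) (q powi (- int t)))"
      proof (rule sum.cong)
        fix i assume "i \<in> {..s}"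
        then have "poly (G i) (q powi (- int t)) = \<kappa> i r1 r2 t" unfolding G_def using s by (intro poly_F[OF r _ t]) auto
        then show "c i * \<kappa> i r1 r2 t = c i * poly (G i) (q powi (- int t))" by simp
      qed simp
      also have "\<dots> = 0" by (rule P)
      finally show "(\<Sum>i\<le>N r1 r2. (if i \<le> s then c i else 0) * \<kappa> i r1 r2 t) = 0" .
    qed
    then show False using c(1) s by (metis atMost_iff le_trans)
  qed
qed


section \<open>Adjoints\<close>

abbreviation kpoly :: "nat \<Rightarrow> nat \<Rightarrow> nat \<Rightarrow> complex poly" where
  "kpoly s r1 r2 \<equiv> kernel_poly q n s r1 r2 (\<kappa> s r1 r2)"

text \<open>The right-hand side of the last formula in (d), which is also the explicit factor in
  (e).\<close>

definition adjoint_ratio :: "nat \<Rightarrow> nat \<Rightarrow> nat \<Rightarrow> complex" where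
  "adjoint_ratio s r1 r2 = q powi (int s * (int r2 - int r1))
    * ((qpoch (q ^ r1) (inverse q) s * qpoch (q ^ (n - r2)) (inverse q) s)
       / (qpoch (q ^ (n - r1)) (inverse q) s * qpoch (q ^ r2) (inverse q) s))"

context
  fixes r1 r2 s
  assumes r: "r1 \<le> n" "r2 \<le> n" and s: "s \<le> N r1 r2"
begin

lemma s_swap: "s \<le> N r2 r1"
  using s by (simp add: grass_N_swap)

lemma inner_cnj: "cnj (inner m \<phi> \<psi>) = inner m \<psi> \<phi>"
  by (simp add: grass_inner_def mult.commute)

text \<open>Exchanging the two arguments shifts the distance by \<open>r2 - r1\<close>, since both
  distances come from the same meet. Adding \<open>r2\<close> before subtracting \<open>r1\<close>
  avoids truncation on \<open>I r2 r1\<close>.\<close>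

lemma adjoint_kernel:
  "\<exists>C. (\<forall>t\<in>I r2 r1. cnj (\<kappa> s r1 r2 (t + r2 - r1)) = C * \<kappa> s r2 r1 t)
    \<and> (\<forall>\<phi>\<in>V r1. \<forall>\<psi>\<in>V r2. inner r2 (\<Lambda> s r1 r2 \<phi>) \<psi> = inner r1 \<phi> (fscale C (\<Lambda> s r2 r1 \<psi>)))"
proof -
  define g where "g t = cnj (\<kappa> s r1 r2 (t + r2 - r1))" for t
  have adj: "inner r2 (\<Lambda> s r1 r2 \<phi>) \<psi> = inner r1 \<phi> (kop r2 r1 g \<psi>)" if "\<phi> \<in> V r1" for \<phi> \<psi>
  proof -
    have "inner r2 (\<Lambda> s r1 r2 \<phi>) \<psi> = (\<Sum>x2\<in>X r2. \<Sum>x1\<in>X r1. \<kappa> s r1 r2 (dist x2 x1) * \<phi> x1 * cnj (\<psi> x2))"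
      by (simp add: \<Lambda>_eq_kop[OF r s that] grass_inner_def kop_def sum_distrib_right)
    also have "\<dots> = (\<Sum>x1\<in>X r1. \<Sum>x2\<in>X r2. \<kappa> s r1 r2 (dist x2 x1) * \<phi> x1 * cnj (\<psi> x2))"
      by (rule sum.swap)
    also have "\<dots> = (\<Sum>x1\<in>X r1. \<Sum>x2\<in>X r2. \<phi> x1 * (\<kappa> s r1 r2 (dist x1 x2 + r2 - r1) * cnj (\<psi> x2)))"
    proof (intro sum.cong refl)
      fix x1 x2 assume x: "x1 \<in> X r1" "x2 \<in> X r2"
      have "dist x2 x1 = dist x1 x2 + r2 - r1"
        using dim_Int_eq_dist(1,2)[OF x(1), of x2] dim_Int_eq_dist(1,2)[OF x(2), of x1]
        unfolding Int_commute[of x2] by linarith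
      then show "\<kappa> s r1 r2 (dist x2 x1) * \<phi> x1 * cnj (\<psi> x2)
          = \<phi> x1 * (\<kappa> s r1 r2 (dist x1 x2 + r2 - r1) * cnj (\<psi> x2))" by simp
    qed
    also have "\<dots> = inner r1 \<phi> (kop r2 r1 g \<psi>)"
      by (simp add: grass_inner_def kop_def g_def sum_distrib_left)
    finally show ?thesis .
  qed
  obtain C where C: "\<And>t. t \<in> I r2 r1 \<Longrightarrow> g t = (if s \<le> N r2 r1 then C * \<kappa> s r2 r1 t else 0)"
  proof (rule kernel_single_component[OF r(2,1)])
    fix j \<phi> \<psi> assume j: "j \<le> N r2 r1" "j \<noteq> s" "\<phi> \<in> W r2 j" "\<psi> \<in> W r1 j"
    have \<psi>: "\<psi> \<in> V r1" using component_subset[OF r(1) index_le(2)[OF j(1)]] j by blast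
    \<comment> \<open>Moving the operator back across the inner product leaves
      \<open>\<Lambda> s r1 r2\<close> acting on another component, where it is 0.\<close>
    have "inner r1 (kop r2 r1 g \<phi>) \<psi> = cnj (inner r2 (\<Lambda> s r1 r2 \<psi>) \<phi>)"
      unfolding adj[OF \<psi>] by (simp add: inner_cnj)
    also have "\<Lambda> s r1 r2 \<psi> = 0" by (rule \<Lambda>_other_component[OF r s index_le(2)[OF j(1)] j(2,4)])
    finally show "inner r1 (kop r2 r1 g \<phi>) \<psi> = 0" by (simp add: grass_inner_def)
  qed auto
  have C': "g t = C * \<kappa> s r2 r1 t" if "t \<in> I r2 r1" for t using C[OF that] s_swap by simp
  have "kop r2 r1 g \<psi> = fscale C (\<Lambda> s r2 r1 \<psi>)" if "\<psi> \<in> V r2" for \<psi>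
  proof -
    have "kop r2 r1 g \<psi> = kop r2 r1 (\<lambda>t. C * \<kappa> s r2 r1 t) \<psi>" by (rule kop_cong) (rule C')
    also have "\<dots> = fscale C (kop r2 r1 (\<kappa> s r2 r1) \<psi>)"
      by (simp add: kop_def fscale_def fun_eq_iff sum_distrib_left mult.assoc)
    finally show ?thesis by (simp add: \<Lambda>_eq_kop[OF r(2,1) s_swap that])
  qed
  then show ?thesis using adj C' unfolding g_def by (intro exI[of _ C]) auto
qed

text \<open>Up to constants, the adjoint relation equates the polynomial for
  \<open>(r1, r2)\<close>, rescaled in its argument, with that for \<open>(r2, r1)\<close> at enough
  points. The adjoint identity is kept in the same statement because one constant \<open>C\<close>
  governs both.\<close>

lemma kernel_poly_reflection:
  "\<exists>c0. c0 \<noteq> 0 \<and> (\<forall>u. poly (kpoly s r1 r2) u = c0 * poly (kpoly s r2 r1) (q powi (int r2 - int r1) * u))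
    \<and> (\<forall>\<phi>\<in>V r1. \<forall>\<psi>\<in>V r2. inner r2 (\<Lambda> s r1 r2 \<phi>) \<psi>
        = inner r1 \<phi> (fscale (cnj (poly (kpoly s r1 r2) 1) / poly (kpoly s r1 r2) 1 * c0) (\<Lambda> s r2 r1 \<psi>)))"
proof -
  obtain C where C: "\<And>t. t \<in> I r2 r1 \<Longrightarrow> cnj (\<kappa> s r1 r2 (t + r2 - r1)) = C * \<kappa> s r2 r1 t"
    and adj: "\<forall>\<phi>\<in>V r1. \<forall>\<psi>\<in>V r2. inner r2 (\<Lambda> s r1 r2 \<phi>) \<psi> = inner r1 \<phi> (fscale C (\<Lambda> s r2 r1 \<psi>))"
    using adjoint_kernel by metis
  define d where "d = cnj (poly (kpoly s r1 r2) 1) / poly (kpoly s r1 r2) 1"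
  have f1: "poly (kpoly s r1 r2) 1 \<noteq> 0" by (rule poly_F_1_nonzero[OF r s])
  then have d: "d \<noteq> 0" by (simp add: d_def)
  define a where "a = q powi (int r1 - int r2)"
  have comp: "smult d (pcompose (kpoly s r1 r2) [:0, a:]) = smult C (kpoly s r2 r1)"
  proof (rule poly_eq_on_I[OF r(2,1) s_swap])
    show "degree (smult d (pcompose (kpoly s r1 r2) [:0, a:])) \<le> s"
      using degree_F_le[OF r s] by (simp add: a_def degree_pcompose)
    show "degree (smult C (kpoly s r2 r1)) \<le> s"
      using degree_F_le[OF r(2,1) s_swap] by simp
  next
    fix t assume t: "t \<in> I r2 r1"
    then have t': "t + r2 - r1 \<in> I r1 r2" "r1 \<le> t + r2" using r by (auto simp: grass_I_eq)
    have u: "a * q powi (- int t) = q powi (- int (t + r2 - r1))"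
    proof -
      have "a * q powi (- int t) = q powi (int r1 - int r2 + - int t)"
        unfolding a_def by (rule power_int_add[symmetric]) simp
      also have "int r1 - int r2 + - int t = - int (t + r2 - r1)" using t'(2) by (simp add: of_nat_diff)
      finally show ?thesis .
    qed
    have "q powi (- int (t + r2 - r1)) \<in> \<real>"
      by (simp add: q_eq complex_is_Real_iff[symmetric] Reals_cnj_iff cnj_power_int)
    then have "d * poly (kpoly s r1 r2) (q powi (- int (t + r2 - r1)))
        = cnj (poly (kpoly s r1 r2) (q powi (- int (t + r2 - r1))))"
      unfolding d_def by (intro cnj_poly_F[OF r s, symmetric]) auto
    also have "\<dots> = C * poly (kpoly s r2 r1) (q powi (- int t))"
      using C[OF t] poly_F[OF r s t'(1)] poly_F[OF r(2,1) s_swap t] by simp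
    finally show "poly (smult d (pcompose (kpoly s r1 r2) [:0, a:])) (q powi (- int t))
        = poly (smult C (kpoly s r2 r1)) (q powi (- int t))"
      by (simp add: poly_pcompose mult.commute[of _ a] u)
  qed
  have eq: "poly (kpoly s r1 r2) u = C / d * poly (kpoly s r2 r1) (q powi (int r2 - int r1) * u)" for u
  proof -
    have a: "q powi (int r2 - int r1) * u * a = u"
    proof -
      have "q powi (int r2 - int r1) * a = q powi (int r2 - int r1 + (int r1 - int r2))"
        unfolding a_def by (rule power_int_add[symmetric]) simp
      then show ?thesis by (simp add: mult.commute mult.left_commute)
    qed
    have "d * poly (kpoly s r1 r2) u = C * poly (kpoly s r2 r1) (q powi (int r2 - int r1) * u)"
      using arg_cong[OF comp, of "\<lambda>p. poly p (q powi (int r2 - int r1) * u)"]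
      by (simp only: poly_smult poly_pcompose poly_pCons poly_0 a mult_zero_right add_0_left add_0_right)
    then show ?thesis using d by (simp add: field_simps)
  qed
  have "C / d \<noteq> 0"
  proof
    assume "C / d = 0"
    then show False using eq[of 1] f1 by simp
  qed
  moreover have "d * (C / d) = C" using d by simp
  ultimately show ?thesis using eq adj unfolding d_def[symmetric] by (intro exI[of _ "C / d"]) simp
qed

end

text \<open>The reflection takes \<open>q powi (- r2)\<close> to \<open>q powi (- r1)\<close> and
  \<open>q powi (r1 - r2)\<close> to 1. Dividing the first ratio of (d) for \<open>(r1, r2)\<close>
  by that for \<open>(r2, r1)\<close> therefore determines \<open>c0\<close>; signs and binomial
  exponents cancel.\<close>

lemma poly_ratio_at_reflection:
  assumes r: "r1 \<le> n" "r2 \<le> n" and s: "s \<le> N r1 r2"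
    and c0: "\<And>u. poly (kpoly s r1 r2) u = c0 * poly (kpoly s r2 r1) (q powi (int r2 - int r1) * u)"
  shows "poly (kpoly s r1 r2) (q powi (int r1 - int r2)) / poly (kpoly s r1 r2) 1 = adjoint_ratio s r1 r2"
    and "c0 * poly (kpoly s r2 r1) 1 / poly (kpoly s r1 r2) 1 = adjoint_ratio s r1 r2"
proof -
  have s': "s \<le> N r2 r1" using s by (simp add: grass_N_swap)
  note b = index_bounds[OF r s]
  have pw: "q powi (int r2 - int r1) * q powi (int r1 - int r2) = 1"
    "q powi (int r2 - int r1) * q powi (- int r2) = q powi (- int r1)"
    by (simp_all flip: power_int_add)
  have e1: "poly (kpoly s r1 r2) (q powi (int r1 - int r2)) = c0 * poly (kpoly s r2 r1) 1"
    unfolding c0 pw ..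
  have e2: "poly (kpoly s r1 r2) (q powi (- int r2)) = c0 * poly (kpoly s r2 r1) (q powi (- int r1))"
    unfolding c0 pw ..
  have f: "poly (kpoly s r1 r2) 1 \<noteq> 0" "poly (kpoly s r2 r1) 1 \<noteq> 0"
    by (rule poly_F_1_nonzero[OF r s], rule poly_F_1_nonzero[OF r(2,1) s'])
  define A B where "A = poly (kpoly s r1 r2) (q powi (- int r2)) / poly (kpoly s r1 r2) 1"
    and "B = poly (kpoly s r2 r1) (q powi (- int r1)) / poly (kpoly s r2 r1) 1"
  have A: "A = (- 1) ^ s * q powi (int (s choose 2) - int r1 * int s)
    * (qpoch (q ^ r1) (inverse q) s / qpoch (q ^ (n - r1)) (inverse q) s)"
    unfolding A_def poly_F_ratio_left[OF r s] by (rule kernel_ratio_to_degree[OF r s])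
  have B: "B = (- 1) ^ s * q powi (int (s choose 2) - int r2 * int s)
    * (qpoch (q ^ r2) (inverse q) s / qpoch (q ^ (n - r2)) (inverse q) s)"
    unfolding B_def poly_F_ratio_left[OF r(2,1) s'] by (rule kernel_ratio_to_degree[OF r(2,1) s'])
  have nz: "qpoch (q ^ r2) (inverse q) s \<noteq> 0" "qpoch (q ^ (n - r2)) (inverse q) s \<noteq> 0"
    using b by (simp_all add: qpoch_power_nonzero)
  have "B \<noteq> 0" unfolding B using nz by simp
  have AB: "A = c0 * poly (kpoly s r2 r1) 1 / poly (kpoly s r1 r2) 1 * B"
    unfolding A_def B_def e2 using f by simp
  have "q powi (int (s choose 2) - int r1 * int s)
      = q powi (int s * (int r2 - int r1)) * q powi (int (s choose 2) - int r2 * int s)"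
    by (simp add: algebra_simps flip: power_int_add)
  then have "A = adjoint_ratio s r1 r2 * B"
    unfolding A B adjoint_ratio_def using nz by (simp add: field_simps)
  with AB \<open>B \<noteq> 0\<close> show 1: "c0 * poly (kpoly s r2 r1) 1 / poly (kpoly s r1 r2) 1 = adjoint_ratio s r1 r2"
    by (metis mult_right_cancel)
  then show "poly (kpoly s r1 r2) (q powi (int r1 - int r2)) / poly (kpoly s r1 r2) 1 = adjoint_ratio s r1 r2"
    unfolding e1 .
qed

text \<open>The constant \<open>c0\<close> in the adjoint identity is replaced by its value from
  \<open>poly_ratio_at_reflection\<close>.\<close>

lemma grass_adjoint_component_map:
  assumes r: "r1 \<le> n" "r2 \<le> n" and s: "s \<le> N r1 r2"
  shows "grass_adjoint scale r1 r2 (\<Lambda> s r1 r2)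
    (\<lambda>\<psi>. fscale (cnj (poly (kpoly s r1 r2) 1) / poly (kpoly s r2 r1) 1 * adjoint_ratio s r1 r2) (\<Lambda> s r2 r1 \<psi>))"
proof -
  have s': "s \<le> N r2 r1" using s by (simp add: grass_N_swap)
  obtain c0 where c0: "\<And>u. poly (kpoly s r1 r2) u = c0 * poly (kpoly s r2 r1) (q powi (int r2 - int r1) * u)"
    and adj: "\<forall>\<phi>\<in>V r1. \<forall>\<psi>\<in>V r2. inner r2 (\<Lambda> s r1 r2 \<phi>) \<psi>
        = inner r1 \<phi> (fscale (cnj (poly (kpoly s r1 r2) 1) / poly (kpoly s r1 r2) 1 * c0) (\<Lambda> s r2 r1 \<psi>))"
    using kernel_poly_reflection[OF r s] by metis
  have "cnj (poly (kpoly s r1 r2) 1) / poly (kpoly s r2 r1) 1 * adjoint_ratio s r1 r2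
      = cnj (poly (kpoly s r1 r2) 1) / poly (kpoly s r1 r2) 1 * c0"
    unfolding poly_ratio_at_reflection(2)[OF r s c0, symmetric] using poly_F_1_nonzero[OF r(2,1) s'] by simp
  moreover have "fscale c (\<Lambda> s r2 r1 \<psi>) \<in> V r1" if "\<psi> \<in> V r2" for c \<psi>
  proof -
    have "\<Lambda> s r2 r1 \<psi> \<in> V r1"
      unfolding \<Lambda>_eq_kop[OF r(2,1) s' that] by (rule kop_mem_V)
    then show ?thesis by (simp add: grass_fun_def fscale_def)
  qed
  ultimately show ?thesis unfolding grass_adjoint_def using adj by simp
qed

end


theorem theorem5p4:
  fixes scale :: "'k::{field,finite} \<Rightarrow> 'v::ab_group_add \<Rightarrow> 'v"
    and Basis :: "'v set"
    and n :: nat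
    and q :: complex
    and U :: "nat \<Rightarrow> ('i \<Rightarrow> complex) set"
    and \<pi> :: "nat \<Rightarrow> ('v \<Rightarrow> 'v) \<Rightarrow> ('i \<Rightarrow> complex) \<Rightarrow> ('i \<Rightarrow> complex)"
    and W :: "nat \<Rightarrow> nat \<Rightarrow> ('v set \<Rightarrow> complex) set"
    and \<Lambda> :: "nat \<Rightarrow> nat \<Rightarrow> nat \<Rightarrow> ('v set \<Rightarrow> complex) \<Rightarrow> ('v set \<Rightarrow> complex)"
    and \<kappa> :: "nat \<Rightarrow> nat \<Rightarrow> nat \<Rightarrow> nat \<Rightarrow> complex"
    and f :: "nat \<Rightarrow> nat \<Rightarrow> nat \<Rightarrow> complex poly"
  assumes \<Omega>: "finite_dimensional_vector_space scale Basis"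
    and n: "n = vector_space.dim scale (UNIV :: 'v set)"
    and q: "q = of_nat (card (UNIV :: 'k set))"
    and decomposition: "grass_decomposition scale n U \<pi> W"
    and \<Lambda>: "\<And>s r1 r2. \<lbrakk>r1 \<le> n; r2 \<le> n; s \<le> grass_N n r1 r2\<rbrakk> \<Longrightarrow>
               component_map scale r1 (W r1 s) (W r2 s) (\<Lambda> s r1 r2)"
    and \<kappa>: "\<And>s r1 r2. \<lbrakk>r1 \<le> n; r2 \<le> n; s \<le> grass_N n r1 r2\<rbrakk> \<Longrightarrow>
               has_kernel scale r1 r2 (\<Lambda> s r1 r2) (\<kappa> s r1 r2)"
    and f: "\<And>s r1 r2. f s r1 r2 = kernel_poly q n s r1 r2 (\<kappa> s r1 r2)"
  shows
    \<comment> \<open>(a)\<close>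
    "(\<forall>s r. 2 * s \<le> n \<and> s \<le> r \<and> r \<le> n - s \<longrightarrow>
        (\<forall>t\<le>s. \<kappa> s r s t =
            qpoch (q powi (int s - int r - 1)) (inverse q) t / qpoch (q ^ (n - r)) (inverse q) t
              * \<kappa> s r s 0 \<and>
          \<kappa> s (n - s) r t =
            qpoch (q powi (int r + int s - int n - 1)) (inverse q) t / qpoch (q ^ r) (inverse q) t
              * \<kappa> s (n - s) r 0) \<and>
        \<kappa> s r s 0 \<noteq> 0 \<and> \<kappa> s (n - s) r 0 \<noteq> 0)
   \<and> (\<forall>s r1 r2. r1 \<le> n \<and> r2 \<le> n \<and> s \<le> grass_N n r1 r2 \<longrightarrow>
        \<comment> \<open>(b)\<close>
        (\<exists>!p. is_kernel_poly q n s r1 r2 (\<kappa> s r1 r2) p) \<and>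
        f s r1 r2 \<noteq> 0 \<and> degree (f s r1 r2) = s \<and>
        (\<exists>c1 c2. c1 \<noteq> 0 \<and> c2 \<noteq> 0 \<and>
           (\<forall>u. u \<noteq> 0 \<longrightarrow>
              poly (f s r1 r2) u = c1 * kernel_sum q s r2 (\<kappa> s r1 s) u \<and>
              poly (f s r1 r2) u = c2 * kernel_sum q s (n - r1) (\<kappa> s (n - s) r2) u)) \<and>
        \<comment> \<open>(c)\<close>
        (\<exists>c0. c0 \<noteq> 0 \<and>
           (\<forall>u. poly (f s r1 r2) u = c0 * poly (f s r2 r1) (q powi (int r2 - int r1) * u))) \<and>
        \<comment> \<open>(d)\<close>
        poly (f s r1 r2) 1 \<noteq> 0 \<and>
        poly (f s r1 r2) (q powi (- int r2)) / poly (f s r1 r2) 1 = \<kappa> s r1 s s / \<kappa> s r1 s 0 \<and>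
        \<kappa> s r1 s s / \<kappa> s r1 s 0 =
          (- 1) ^ s * q powi (int (s choose 2) - int r1 * int s)
            * (qpoch (q ^ r1) (inverse q) s / qpoch (q ^ (n - r1)) (inverse q) s) \<and>
        poly (f s r1 r2) (q powi (int r1 - int n)) / poly (f s r1 r2) 1 =
          \<kappa> s (n - s) r2 s / \<kappa> s (n - s) r2 0 \<and>
        \<kappa> s (n - s) r2 s / \<kappa> s (n - s) r2 0 =
          (- 1) ^ s * q powi (int (s choose 2) + int s * (int r2 - int n))
            * (qpoch (q ^ (n - r2)) (inverse q) s / qpoch (q ^ r2) (inverse q) s) \<and>
        poly (f s r1 r2) (q powi (int r1 - int r2)) / poly (f s r1 r2) 1 =
          q powi (int s * (int r2 - int r1))
            * ((qpoch (q ^ r1) (inverse q) s * qpoch (q ^ (n - r2)) (inverse q) s)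
               / (qpoch (q ^ (n - r1)) (inverse q) s * qpoch (q ^ r2) (inverse q) s)) \<and>
        \<comment> \<open>(e): taking adjoints is conjugate linear and \<open>\<Lambda> s r1 r2\<close> may be rescaled by any nonzero
             complex number, hence the conjugation of \<open>f s r1 r2\<close> at 1\<close>
        grass_adjoint scale r1 r2 (\<Lambda> s r1 r2)
          (\<lambda>\<psi>. fscale
             (cnj (poly (f s r1 r2) 1) / poly (f s r2 r1) 1 * q powi (int s * (int r2 - int r1))
                * ((qpoch (q ^ r1) (inverse q) s * qpoch (q ^ (n - r2)) (inverse q) s)
                   / (qpoch (q ^ (n - r1)) (inverse q) s * qpoch (q ^ r2) (inverse q) s)))
             (\<Lambda> s r2 r1 \<psi>)))"
proof -
  interpret finite_dimensional_vector_space scale Basis by (rule \<Omega>)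
  interpret G: grass_component_maps scale Basis q n U \<pi> W \<Lambda> \<kappa>
    by unfold_locales (use n q decomposition \<Lambda> \<kappa> in auto)
  show ?thesis
  proof (rule conjI; intro allI impI)
    fix s r assume s: "2 * s \<le> n \<and> s \<le> r \<and> r \<le> n - s"
    show "(\<forall>t\<le>s. \<kappa> s r s t =
            qpoch (q powi (int s - int r - 1)) (inverse q) t / qpoch (q ^ (n - r)) (inverse q) t
              * \<kappa> s r s 0 \<and>
          \<kappa> s (n - s) r t =
            qpoch (q powi (int r + int s - int n - 1)) (inverse q) t / qpoch (q ^ r) (inverse q) t
              * \<kappa> s (n - s) r 0) \<and>
        \<kappa> s r s 0 \<noteq> 0 \<and> \<kappa> s (n - s) r 0 \<noteq> 0"
      using G.kernel_to_degree[of s r] G.kernel_from_codegree[of s r]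
        G.kernel_to_degree_0[of s r] G.kernel_from_codegree_0[of s r] s by blast
  next
    fix s r1 r2 assume "r1 \<le> n \<and> r2 \<le> n \<and> s \<le> grass_N n r1 r2"
    then have r: "r1 \<le> n" "r2 \<le> n" and s: "s \<le> grass_N n r1 r2" by auto
    obtain c1 c2 where c: "c1 \<noteq> 0" "c2 \<noteq> 0"
      "\<forall>u. u \<noteq> 0 \<longrightarrow> poly (f s r1 r2) u = c1 * kernel_sum q s r2 (\<kappa> s r1 s) u"
      "\<forall>u. u \<noteq> 0 \<longrightarrow> poly (f s r1 r2) u = c2 * kernel_sum q s (n - r1) (\<kappa> s (n - s) r2) u"
      using G.kernel_poly_left[OF r s] G.kernel_poly_right[OF r s] unfolding f by blast
    then have b: "\<exists>c1 c2. c1 \<noteq> 0 \<and> c2 \<noteq> 0 \<and>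
           (\<forall>u. u \<noteq> 0 \<longrightarrow>
              poly (f s r1 r2) u = c1 * kernel_sum q s r2 (\<kappa> s r1 s) u \<and>
              poly (f s r1 r2) u = c2 * kernel_sum q s (n - r1) (\<kappa> s (n - s) r2) u)" by blast
    obtain c0 where c0: "c0 \<noteq> 0" "\<And>u. poly (f s r1 r2) u = c0 * poly (f s r2 r1) (q powi (int r2 - int r1) * u)"
      using G.kernel_poly_reflection[OF r s] unfolding f by blast
    \<comment> \<open>These are the remaining assertions of (b), (d) and (e), in the order of the
      conclusion; the two kernel sums and the reflection are supplied by \<open>b\<close> and
      \<open>c0\<close>.\<close>
    note P = G.kernel_poly_ex1[OF r s] G.F_nonzero[OF r s, folded f] G.degree_kernel_poly[OF r s, folded f]
      G.poly_F_1_nonzero[OF r s, folded f]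
      G.poly_F_ratio_left[OF r s, folded f] G.kernel_ratio_to_degree[OF r s]
      G.poly_F_ratio_right[OF r s, folded f] G.kernel_ratio_from_codegree[OF r s]
      G.poly_ratio_at_reflection(1)[OF r s c0(2)[unfolded f], folded f, unfolded G.adjoint_ratio_def]
      G.grass_adjoint_component_map[OF r s, folded f, unfolded G.adjoint_ratio_def mult.assoc[symmetric]]
    show "(\<exists>!p. is_kernel_poly q n s r1 r2 (\<kappa> s r1 r2) p) \<and>
        f s r1 r2 \<noteq> 0 \<and> degree (f s r1 r2) = s \<and>
        (\<exists>c1 c2. c1 \<noteq> 0 \<and> c2 \<noteq> 0 \<and>
           (\<forall>u. u \<noteq> 0 \<longrightarrow>
              poly (f s r1 r2) u = c1 * kernel_sum q s r2 (\<kappa> s r1 s) u \<and>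
              poly (f s r1 r2) u = c2 * kernel_sum q s (n - r1) (\<kappa> s (n - s) r2) u)) \<and>
        (\<exists>c0. c0 \<noteq> 0 \<and>
           (\<forall>u. poly (f s r1 r2) u = c0 * poly (f s r2 r1) (q powi (int r2 - int r1) * u))) \<and>
        poly (f s r1 r2) 1 \<noteq> 0 \<and>
        poly (f s r1 r2) (q powi (- int r2)) / poly (f s r1 r2) 1 = \<kappa> s r1 s s / \<kappa> s r1 s 0 \<and>
        \<kappa> s r1 s s / \<kappa> s r1 s 0 =
          (- 1) ^ s * q powi (int (s choose 2) - int r1 * int s)
            * (qpoch (q ^ r1) (inverse q) s / qpoch (q ^ (n - r1)) (inverse q) s) \<and>
        poly (f s r1 r2) (q powi (int r1 - int n)) / poly (f s r1 r2) 1 =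
          \<kappa> s (n - s) r2 s / \<kappa> s (n - s) r2 0 \<and>
        \<kappa> s (n - s) r2 s / \<kappa> s (n - s) r2 0 =
          (- 1) ^ s * q powi (int (s choose 2) + int s * (int r2 - int n))
            * (qpoch (q ^ (n - r2)) (inverse q) s / qpoch (q ^ r2) (inverse q) s) \<and>
        poly (f s r1 r2) (q powi (int r1 - int r2)) / poly (f s r1 r2) 1 =
          q powi (int s * (int r2 - int r1))
            * ((qpoch (q ^ r1) (inverse q) s * qpoch (q ^ (n - r2)) (inverse q) s)
               / (qpoch (q ^ (n - r1)) (inverse q) s * qpoch (q ^ r2) (inverse q) s)) \<and>
        grass_adjoint scale r1 r2 (\<Lambda> s r1 r2)
          (\<lambda>\<psi>. fscale
             (cnj (poly (f s r1 r2) 1) / poly (f s r2 r1) 1 * q powi (int s * (int r2 - int r1))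
                * ((qpoch (q ^ r1) (inverse q) s * qpoch (q ^ (n - r2)) (inverse q) s)
                   / (qpoch (q ^ (n - r1)) (inverse q) s * qpoch (q ^ r2) (inverse q) s)))
             (\<Lambda> s r2 r1 \<psi>))"
    proof (intro conjI)
      show "\<exists>c0. c0 \<noteq> 0 \<and>
           (\<forall>u. poly (f s r1 r2) u = c0 * poly (f s r2 r1) (q powi (int r2 - int r1) * u))"
        using c0 by blast
    qed (rule b P)+
  qed
qed

end
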